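(* Given a graph with $n$ vertices together with a $B_1$-EPG representation in which only three of the four shapes $\ulcorner,\urcorner,\llcorner,\lrcorner$ are used, and an integer $k$, the question whether the graph has an independent set of size at least $k$ (i.e. $OPT \ge k$) can be solved in time $O(k^{2k}\,poly(n))$.
   Context: An EPG representation of a graph $G=(V,E)$ consists of a rectangular grid and a family of simple paths $\{P_v : v\in V\}$ in the grid such that $\{u,v\}\in E$ if and only if $P_u$ and $P_v$ share at least one grid edge (crossing at a grid vertex does not create an edge). $B_1$-EPG is the class of graphs having such a representation in which every path has at most one bend. A one-bend path has one of four shapes: $\llcorner$ (vertical part going up and horizontal part going right from the corner), $\ulcorner$ (down and right), $\urcorner$ (down and left), $\lrcorner$ (up and left); paths with no bend are regarded as degenerate instances of a shape. *)

theory Defs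
  imports "HOL-Computational_Algebra.Polynomial"
begin

section \<open>Graphs and independent sets\<close>

definition simple_graph :: "'v set \<Rightarrow> 'v set set \<Rightarrow> bool" where
  "simple_graph V E \<longleftrightarrow> finite V \<and> (\<forall>e\<in>E. e \<subseteq> V \<and> card e = 2)"

definition independent_set :: "'v set \<Rightarrow> 'v set set \<Rightarrow> 'v set \<Rightarrow> bool" where
  "independent_set V E S \<longleftrightarrow> S \<subseteq> V \<and> (\<forall>u\<in>S. \<forall>v\<in>S. {u, v} \<notin> E)"


section \<open>EPG representations\<close>

text \<open>Grid points are pairs (column, row); rows are numbered upwards.\<close>

type_synonym point = "nat \<times> nat"

definition grid :: "nat \<Rightarrow> nat \<Rightarrow> point set" where
  "grid W H = {..<W} \<times> {..<H}"

definition grid_adj :: "point \<Rightarrow> point \<Rightarrow> bool" where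
  "grid_adj p q \<longleftrightarrow>
     (fst p = fst q \<and> (snd q = Suc (snd p) \<or> snd p = Suc (snd q))) \<or>
     (snd p = snd q \<and> (fst q = Suc (fst p) \<or> fst p = Suc (fst q)))"

definition grid_path :: "nat \<Rightarrow> nat \<Rightarrow> point list \<Rightarrow> bool" where
  "grid_path W H ps \<longleftrightarrow>
     ps \<noteq> [] \<and> distinct ps \<and> set ps \<subseteq> grid W H \<and> successively grid_adj ps"

definition path_edges :: "point list \<Rightarrow> point set set" where
  "path_edges ps = {{ps ! i, ps ! Suc i} | i. Suc i < length ps}"

definition EPG_rep ::
  "'v set \<Rightarrow> 'v set set \<Rightarrow> nat \<Rightarrow> nat \<Rightarrow> ('v \<Rightarrow> point list) \<Rightarrow> bool" where
  "EPG_rep V E W H P \<longleftrightarrow>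
     (\<forall>v\<in>V. grid_path W H (P v)) \<and>
     (\<forall>u\<in>V. \<forall>v\<in>V. u \<noteq> v \<longrightarrow>
        ({u, v} \<in> E \<longleftrightarrow> path_edges (P u) \<inter> path_edges (P v) \<noteq> {}))"

text \<open>The path bends at its point number \<open>Suc i\<close>.\<close>

definition bend_at :: "point list \<Rightarrow> nat \<Rightarrow> bool" where
  "bend_at ps i \<longleftrightarrow> Suc (Suc i) < length ps \<and>
     fst (ps ! i) \<noteq> fst (ps ! Suc (Suc i)) \<and> snd (ps ! i) \<noteq> snd (ps ! Suc (Suc i))"

definition B1_EPG_rep ::
  "'v set \<Rightarrow> 'v set set \<Rightarrow> nat \<Rightarrow> nat \<Rightarrow> ('v \<Rightarrow> point list) \<Rightarrow> bool" where
  "B1_EPG_rep V E W H P \<longleftrightarrow>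
     EPG_rep V E W H P \<and> (\<forall>v\<in>V. card {i. bend_at (P v) i} \<le> 1)"

definition seg :: "nat \<Rightarrow> nat \<Rightarrow> nat list" where
  "seg a b = (if a \<le> b then [a..<Suc b] else rev [b..<Suc a])"

text \<open>\<open>corner_path x y a b\<close> leads from \<open>(x, a)\<close> vertically to the corner \<open>(x, y)\<close> and
  then horizontally to \<open>(b, y)\<close>.  Either part may have length \<open>0\<close>.\<close>

definition corner_path :: "nat \<Rightarrow> nat \<Rightarrow> nat \<Rightarrow> nat \<Rightarrow> point list" where
  "corner_path x y a b = map (\<lambda>j. (x, j)) (seg a y) @ tl (map (\<lambda>i. (i, y)) (seg x b))"

datatype shape = Up_Right | Down_Right | Down_Left | Up_Left

fun arms :: "shape \<Rightarrow> nat \<Rightarrow> nat \<Rightarrow> nat \<Rightarrow> nat \<Rightarrow> bool" where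
  "arms Up_Right   x y a b \<longleftrightarrow> y \<le> a \<and> x \<le> b"
| "arms Down_Right x y a b \<longleftrightarrow> a \<le> y \<and> x \<le> b"
| "arms Down_Left  x y a b \<longleftrightarrow> a \<le> y \<and> b \<le> x"
| "arms Up_Left    x y a b \<longleftrightarrow> y \<le> a \<and> b \<le> x"

text \<open>The inequalities are weak, so a path without bend is a degenerate instance of
  every shape; paths are undirected, hence the \<open>rev\<close>.\<close>

definition has_shape :: "shape \<Rightarrow> point list \<Rightarrow> bool" where
  "has_shape s ps \<longleftrightarrow> (\<exists>x y a b. arms s x y a b \<and>
     (ps = corner_path x y a b \<or> ps = rev (corner_path x y a b)))"

definition three_shapes :: "'v set \<Rightarrow> ('v \<Rightarrow> point list) \<Rightarrow> bool" where
  "three_shapes V P \<longleftrightarrow>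
     (\<exists>S. card S = 3 \<and> (\<forall>v\<in>V. \<exists>s\<in>S. has_shape s (P v)))"


section \<open>Model of computation\<close>

text \<open>A first-order functional language over binary trees with natural numbers at the
  leaves.  Every evaluation step costs one unit.  A program is a list of bodies of
  mutually recursive unary functions; variables are de Bruijn indices into the local
  environment, whose size is bounded by a constant depending on the program only.
  Trees are only inspected at the root and there is neither comparison of trees nor
  multiplication of numbers, so each step can be carried out in constant time on a unit-cost
  random access machine with addition and subtraction, trees being stored as pointers to
  pairs.\<close>

datatype val = Num nat | Node val val

datatype expr =
    Var nat
  | Const nat
  | Mk expr expr
  | Left expr
  | Right expr
  | IsNode expr
  | Add expr expr
  | Sub expr expr
  | Leq expr expr
  | Cond expr expr expr
  | Bind expr expr
  | Call nat expr

type_synonym program = "expr list"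

definition val_of_bool :: "bool \<Rightarrow> val" where
  "val_of_bool b = Num (if b then 1 else 0)"

text \<open>\<open>eval p env e v t\<close>: in environment \<open>env\<close> the expression \<open>e\<close> evaluates to \<open>v\<close> in
  exactly \<open>t\<close> steps.  \<open>Sub\<close> is truncated subtraction.\<close>

inductive eval :: "program \<Rightarrow> val list \<Rightarrow> expr \<Rightarrow> val \<Rightarrow> nat \<Rightarrow> bool" for p :: program where
  Var: "i < length env \<Longrightarrow> eval p env (Var i) (env ! i) 1"
| Const: "eval p env (Const m) (Num m) 1"
| Mk: "eval p env e v t \<Longrightarrow> eval p env e' v' t' \<Longrightarrow>
    eval p env (Mk e e') (Node v v') (t + t' + 1)"
| Left: "eval p env e (Node v v') t \<Longrightarrow> eval p env (Left e) v (t + 1)"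
| Right: "eval p env e (Node v v') t \<Longrightarrow> eval p env (Right e) v' (t + 1)"
| IsNode: "eval p env e v t \<Longrightarrow>
    eval p env (IsNode e) (val_of_bool (\<exists>l r. v = Node l r)) (t + 1)"
| Add: "eval p env e (Num m) t \<Longrightarrow> eval p env e' (Num m') t' \<Longrightarrow>
    eval p env (Add e e') (Num (m + m')) (t + t' + 1)"
| Sub: "eval p env e (Num m) t \<Longrightarrow> eval p env e' (Num m') t' \<Longrightarrow>
    eval p env (Sub e e') (Num (m - m')) (t + t' + 1)"
| Leq: "eval p env e (Num m) t \<Longrightarrow> eval p env e' (Num m') t' \<Longrightarrow>
    eval p env (Leq e e') (val_of_bool (m \<le> m')) (t + t' + 1)"
| Cond: "eval p env e (Num m) t \<Longrightarrow> eval p env (if m \<noteq> 0 then e1 else e2) v t' \<Longrightarrow>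
    eval p env (Cond e e1 e2) v (t + t' + 1)"
| Bind: "eval p env e v t \<Longrightarrow> eval p (v # env) e' v' t' \<Longrightarrow>
    eval p env (Bind e e') v' (t + t' + 1)"
| Call: "eval p env e v t \<Longrightarrow> f < length p \<Longrightarrow> eval p [v] (p ! f) v' t' \<Longrightarrow>
    eval p env (Call f e) v' (t + t' + 1)"

inductive_cases eval_elims:
  "eval p env (Var i) v t" "eval p env (Const m) v t" "eval p env (Mk e e') v t"
  "eval p env (Left e) v t" "eval p env (Right e) v t" "eval p env (IsNode e) v t"
  "eval p env (Add e e') v t" "eval p env (Sub e e') v t" "eval p env (Leq e e') v t"
  "eval p env (Cond e e1 e2) v t" "eval p env (Bind e e') v t" "eval p env (Call f e) v t"

lemma eval_deterministic:
  "eval p env e v t \<Longrightarrow> eval p env e w u \<Longrightarrow> v = w \<and> t = u"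
proof (induction arbitrary: w u rule: eval.induct)
  case (Cond env e m t e1 e2 v t')
  from Cond.prems show ?case
    by (rule eval_elims(10)) (use Cond.IH in fastforce)
qed (erule eval_elims; fastforce)+

text \<open>Function number \<open>0\<close> is the entry point of a program.\<close>

definition runs :: "program \<Rightarrow> val \<Rightarrow> val \<Rightarrow> nat \<Rightarrow> bool" where
  "runs p inp out t \<longleftrightarrow> p \<noteq> [] \<and> eval p [inp] (p ! 0) out t"


section \<open>Encoding of the input\<close>

fun val_of_list :: "val list \<Rightarrow> val" where
  "val_of_list [] = Num 0"
| "val_of_list (v # vs) = Node v (val_of_list vs)"

fun val_of_pair :: "nat \<times> nat \<Rightarrow> val" where
  "val_of_pair (a, b) = Node (Num a) (Num b)"

text \<open>A path is given by its first point, its bends, and its last point.\<close>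

definition waypoints :: "point list \<Rightarrow> point list" where
  "waypoints ps =
     hd ps # map (\<lambda>i. ps ! Suc i) (filter (bend_at ps) [0..<length ps]) @ [last ps]"

definition val_of_path :: "point list \<Rightarrow> val" where
  "val_of_path ps = val_of_list (map val_of_pair (waypoints ps))"

text \<open>The input consists of \<open>k\<close>, the dimensions of the grid, the vertices listed in some
  order together with their paths, and the edges listed in some order.\<close>

definition enumerates :: "nat list \<Rightarrow> (nat \<times> nat) list \<Rightarrow> nat set \<Rightarrow> nat set set \<Rightarrow> bool" where
  "enumerates vs es V E \<longleftrightarrow>
     distinct vs \<and> set vs = V \<and> distinct es \<and> (\<lambda>(u, v). {u, v}) ` set es = E"

definition encode_input ::
  "nat list \<Rightarrow> (nat \<times> nat) list \<Rightarrow> nat \<Rightarrow> nat \<Rightarrow> (nat \<Rightarrow> point list) \<Rightarrow> nat \<Rightarrow> val" where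
  "encode_input vs es W H P k = val_of_list
     [Num k, val_of_pair (W, H),
      val_of_list (map (\<lambda>v. Node (Num v) (val_of_path (P v))) vs),
      val_of_list (map val_of_pair es)]"

end

theory Submission
  imports Defs
begin

text \<open>After a reflection of the grid, no path has the shape down-left.  Consider an independent set
  \<open>S\<close> of size \<open>k\<close> and the rightmost path \<open>p\<close> in the topmost row containing a corner of \<open>S\<close>.  Since \<open>p\<close>
  does not go down and left, one of its arms is not obstructed by \<open>S\<close>, so \<open>p\<close> can be exchanged
  greedily: among extremal paths in \<open>k\<close> distinct columns (or rows) one lies in the column of \<open>p\<close>
  or in a column that \<open>S\<close> does not use.  This yields at most \<open>k\<^sup>2 + 2 k\<close> candidates, one of which belongs
  to some independent set of size \<open>k\<close>.  As \<open>k\<^sup>2 + 2 k \<le> 3 k\<^sup>2\<close>, branching over the candidates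
  takes at most \<open>4 ^ k * (k!)\<^sup>2 \<le> 4 * k ^ (2 * k)\<close> steps, up to a polynomial factor in the number of vertices.\<close>

text \<open>The replacement of \<open>p\<close> is chosen without knowing \<open>S\<close>, so it
  may run into members of \<open>S\<close> in its new row or its new column. Along the row of
  \<open>p\<close>, starting no further left than \<open>p\<close> removes the danger. Along a
  column, an upward box whose corner is no lower than any corner of \<open>S\<close> can only meet
  members that contain the grid edge directly above its corner, so it does not matter which way its
  horizontal arm points. A box going down has no such bottleneck. There the column has to determine
  the left end, which needs the corner at the left end, and this is why down-left is the shape to
  exclude. Such a box may also have to change its row, so rows are selected inside each of
  \<open>k\<close> columns, whence \<open>k ^ 2\<close>; the two selections within a single row give
  \<open>2 * k\<close>. The missing shape is not part of the input, so the program tries all four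
  reflections. Each drops the paths that become down-left, so a positive answer is always right, and
  the reflection that sends the missing shape to down-left drops nothing.\<close>

section \<open>The exchange argument\<close>

text \<open>A box is a one-bend path: its corner \<open>(cx, cy)\<close>, its horizontal part from \<open>hl\<close> to \<open>hr\<close> in row
  \<open>cy\<close>, and its vertical part from \<open>vl\<close> to \<open>vr\<close> in column \<open>cx\<close>.\<close>

datatype box = Box (bid: nat) (cx: nat) (cy: nat) (hl: nat) (hr: nat) (vl: nat) (vr: nat)

definition upward :: "box \<Rightarrow> bool" where
  "upward b \<longleftrightarrow> cy b \<le> vl b"

text \<open>Not being \<open>upward\<close> means to have a nonempty arm going down from the corner.  The last line of
  the next definition excludes the shape down-left, and makes the left end the corner of a path
  without vertical part.\<close>

definition box_ok :: "box \<Rightarrow> bool" where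
  "box_ok b \<longleftrightarrow> hl b \<le> hr b \<and> vl b \<le> vr b \<and> hl b \<le> cx b \<and> (cy b = vl b \<or> cy b = vr b) \<and>
     (\<not> upward b \<longrightarrow> cx b = hl b) \<and> (vl b = vr b \<longrightarrow> cx b = hl b)"

definition clash :: "box \<Rightarrow> box \<Rightarrow> bool" where
  "clash p q \<longleftrightarrow>
     cy p = cy q \<and> max (hl p) (hl q) < min (hr p) (hr q) \<or>
     cx p = cx q \<and> max (vl p) (vl q) < min (vr p) (vr q)"

text \<open>A path that is a single point has no edge and does not even clash with itself, so the
  test on identifiers is what removes the chosen box from the list. Identifiers are numbers because
  the language cannot compare trees.\<close>

definition compatible :: "box \<Rightarrow> box \<Rightarrow> bool" where
  "compatible w q \<longleftrightarrow> \<not> clash w q \<and> bid q \<noteq> bid w"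

definition stable :: "box set \<Rightarrow> bool" where
  "stable S \<longleftrightarrow> (\<forall>p\<in>S. \<forall>q\<in>S. p \<noteq> q \<longrightarrow> \<not> clash p q)"

lemma clash_commute: "clash p q \<longleftrightarrow> clash q p"
  by (auto simp: clash_def)

lemma stable_subset: "stable S \<Longrightarrow> T \<subseteq> S \<Longrightarrow> stable T"
  by (auto simp: stable_def)

section \<open>Greedy selection of extremal elements with distinct keys\<close>

fun best :: "('a \<Rightarrow> 'a \<Rightarrow> bool) \<Rightarrow> 'a \<Rightarrow> 'a list \<Rightarrow> 'a" where
  "best le a [] = a"
| "best le a (x # xs) = best le (if le a x then x else a) xs"

lemma best_in: "best le a xs \<in> insert a (set xs)"
proof (induction xs arbitrary: a)
  case (Cons x xs)
  show ?case using Cons[of "if le a x then x else a"] by (auto split: if_splits)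
qed simp

lemma best_ge:
  assumes "\<And>x y. le x y \<or> le y x" "\<And>x y z. le x y \<Longrightarrow> le y z \<Longrightarrow> le x z"
    and "b \<in> insert a (set xs)"
  shows "le b (best le a xs)"
  using assms(3)
proof (induction xs arbitrary: a b)
  case Nil
  then show ?case using assms(1) by auto
next
  case (Cons x xs)
  let ?c = "if le a x then x else a"
  have "\<exists>d\<in>insert ?c (set xs). le b d"
    using Cons.prems assms(1) by auto
  then show ?case
    using Cons.IH assms(2) by (metis best.simps(2))
qed

fun topk :: "('a \<Rightarrow> 'a \<Rightarrow> bool) \<Rightarrow> ('a \<Rightarrow> 'b) \<Rightarrow> nat \<Rightarrow> 'a list \<Rightarrow> 'a list" where
  "topk le key 0 xs = []"
| "topk le key (Suc k) [] = []"
| "topk le key (Suc k) (x # xs) = (let b = best le x xs in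
     b # topk le key k (filter (\<lambda>q. key q \<noteq> key b) (x # xs)))"

lemma topk_subset: "set (topk le key k xs) \<subseteq> set xs"
proof (induction le key k xs rule: topk.induct)
  case (3 le key k x xs)
  then have "set (topk le key k (filter (\<lambda>q. key q \<noteq> key (best le x xs)) (x # xs))) \<subseteq> set (x # xs)"
    using filter_is_subset by fast
  then show ?case
    using best_in[of le x xs] by (simp add: Let_def del: filter.simps)
qed auto

lemma length_topk: "length (topk le key k xs) \<le> k"
  by (induction le key k xs rule: topk.induct) (auto simp: Let_def)

lemma length_filter_best:
  "length (filter (\<lambda>q. key q \<noteq> key (best le x xs)) (x # xs)) \<le> length xs"
proof -
  have "length (filter (\<lambda>q. key q \<noteq> key (best le x xs)) (x # xs)) < length (x # xs)"
    by (rule length_filter_less[OF _ ]) (use best_in[of le x xs] in auto)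
  then show ?thesis by simp
qed

text \<open>Each round removes at least the chosen element. This matters because \<open>k\<close>
  may exceed the number of vertices, while the cost of a selection must be polynomial in the latter
  alone.\<close>

lemma length_topk_le: "length (topk le key k xs) \<le> length xs"
proof (induction le key k xs rule: topk.induct)
  case (3 le key k x xs)
  then show ?case
    using length_filter_best[of key le x xs] by (simp add: Let_def del: filter.simps)
qed auto

lemma topk_ne_Nil: "topk le key k xs = [] \<longleftrightarrow> k = 0 \<or> xs = []"
  by (cases "(le, key, k, xs)" rule: topk.cases) (auto simp: Let_def)

text \<open>As long as \<open>p\<close> survives, every chosen element dominates it. It can vanish
  only in the round that picks its key; otherwise all \<open>k\<close> rounds find an element, and
  their keys differ.\<close>

lemma topk_dominates:
  assumes total: "\<And>x y. le x y \<or> le y x"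
    and trans: "\<And>x y z. le x y \<Longrightarrow> le y z \<Longrightarrow> le x z"
    and "p \<in> set xs"
  shows "(\<exists>w\<in>set (topk le key k xs). key w = key p \<and> le p w) \<or>
    card (key ` set (topk le key k xs)) = k \<and> (\<forall>w\<in>set (topk le key k xs). le p w)"
  using assms(3)
proof (induction k arbitrary: xs)
  case (Suc k zs)
  then obtain x xs where zs: "zs = x # xs" by (cases zs) auto
  define b where "b = best le x xs"
  define ys where "ys = filter (\<lambda>q. key q \<noteq> key b) zs"
  have eq: "topk le key (Suc k) zs = b # topk le key k ys"
    by (simp add: b_def ys_def zs Let_def)
  have pb: "le p b"
    using Suc.prems best_ge[OF total trans] by (simp add: b_def zs)
  show ?case
  proof (cases "key p = key b")
    case True
    then show ?thesis using pb unfolding eq by auto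
  next
    case False
    then have "p \<in> set ys" using Suc.prems by (auto simp: ys_def)
    moreover have "key b \<notin> key ` set (topk le key k ys)"
      using topk_subset[of le key k ys] by (auto simp: ys_def)
    ultimately show ?thesis using Suc.IH[of ys] pb unfolding eq by auto
  qed
qed simp

text \<open>The members of \<open>S\<close> other than \<open>p\<close> have at most \<open>k - 1\<close> keys, so if \<open>topk\<close> does not choose the key
  of \<open>p\<close> then it chooses an unused one.\<close>

lemma topk_exchange:
  assumes "\<And>x y. le x y \<or> le y x" "\<And>x y z. le x y \<Longrightarrow> le y z \<Longrightarrow> le x z" and "p \<in> set xs"
    and "finite S" "p \<in> S" "card S = k"
  obtains w where "w \<in> set (topk le key k xs)" "le p w" "key w = key p \<or> key w \<notin> key ` (S - {p})"
proof (cases "\<exists>w\<in>set (topk le key k xs). key w = key p \<and> le p w")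
  case True
  then show ?thesis using that by blast
next
  case False
  then have c: "card (key ` set (topk le key k xs)) = k" "\<forall>w\<in>set (topk le key k xs). le p w"
    using topk_dominates[of le p xs key k] assms by blast+
  have "card (key ` (S - {p})) < k"
    using assms(4-6) card_image_le[of "S - {p}" key]
    by (metis card_Diff1_less finite_Diff le_less_trans)
  then have "\<not> key ` set (topk le key k xs) \<subseteq> key ` (S - {p})"
    using c(1) card_mono[OF finite_imageI[OF finite_Diff[OF assms(4)]]] by (metis leD)
  then show ?thesis using that c(2) by blast
qed

text \<open>The number \<open>m\<close> replaces a function argument, since the program is
  first-order. Order 0 puts the row first: a box that dominates \<open>p\<close> and lies in a row
  used by \<open>S\<close> is then in the row of \<open>p\<close> and no further left. In order 1,
  ties go to the shorter vertical arm, so that a replacement with the same row and left end does not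
  reach beyond \<open>p\<close>. Order 2 favours arms that reach down least.\<close>

definition box_le :: "nat \<Rightarrow> box \<Rightarrow> box \<Rightarrow> bool" where
  "box_le m p q =
     (if m = 0 then cy p < cy q \<or> cy p = cy q \<and> cx p \<le> cx q
      else if m = 1 then hl p < hl q \<or> hl p = hl q \<and> vr q - vl q \<le> vr p - vl p
      else vl p \<le> vl q)"

definition box_key :: "nat \<Rightarrow> box \<Rightarrow> nat" where
  "box_key m p = (if m = 2 then cy p else cx p)"

lemma box_key_simps: "box_key 0 = cx" "box_key 1 = cx" "box_key 2 = cy"
  by (auto simp: box_key_def)

lemma box_le_total: "box_le m p q \<or> box_le m q p"
  by (auto simp: box_le_def)

lemma box_le_trans: "box_le m p q \<Longrightarrow> box_le m q s \<Longrightarrow> box_le m p s"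
  by (auto simp: box_le_def split: if_splits)

lemma best_box_ge: "b \<in> insert a (set xs) \<Longrightarrow> box_le m b (best (box_le m) a xs)"
  by (rule best_ge[of "box_le m", OF box_le_total]) (erule (1) box_le_trans)

abbreviation "box_topk m \<equiv> topk (box_le m) (box_key m)"

lemma box_topk_exchange:
  assumes "p \<in> set xs" "finite S" "p \<in> S" "card S = k" "box_key m = key"
  obtains w where "w \<in> set (box_topk m k xs)" "box_le m p w"
    "key w = key p \<or> key w \<notin> key ` (S - {p})"
proof (rule topk_exchange[of "box_le m" p xs S k "box_key m"])
  show "box_le m x y \<or> box_le m y x" for x y by (rule box_le_total)
  show "box_le m x z" if "box_le m x y" "box_le m y z" for x y z
    using that by (rule box_le_trans)
qed (use assms that in auto)

lemma box_topk_dominates: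
  assumes "p \<in> set xs"
  shows "(\<exists>w\<in>set (box_topk m k xs). box_key m w = box_key m p \<and> box_le m p w) \<or>
    card (box_key m ` set (box_topk m k xs)) = k \<and> (\<forall>w\<in>set (box_topk m k xs). box_le m p w)"
proof (rule topk_dominates)
  show "box_le m x y \<or> box_le m y x" for x y by (rule box_le_total)
  show "box_le m x z" if "box_le m x y" "box_le m y z" for x y z
    using that by (rule box_le_trans)
qed (rule assms)

section \<open>Candidates and the exchange\<close>

definition row_cands :: "nat \<Rightarrow> box list \<Rightarrow> box list \<Rightarrow> box list" where
  "row_cands k U D = (case U of [] \<Rightarrow> [] | x # xs \<Rightarrow> let u = best (box_le 0) x xs in
     box_topk 1 k (filter (\<lambda>q. cy q = cy u) U) @ box_topk 1 k (filter (\<lambda>q. cy q = cy u) D))"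

definition grid_cands :: "nat \<Rightarrow> box list \<Rightarrow> box list \<Rightarrow> box list" where
  "grid_cands k D cs = concat (map (\<lambda>c. box_topk 2 k (filter (\<lambda>q. cx q = cx c) D)) cs)"

definition cands :: "nat \<Rightarrow> box list \<Rightarrow> box list" where
  "cands k F = (let D = filter (\<lambda>b. \<not> upward b) F in
     row_cands k (filter upward F) D @ grid_cands k D (box_topk 0 k D))"

lemma length_grid_cands: "length (grid_cands k D cs) \<le> length cs * k"
  by (induction cs) (auto simp: grid_cands_def intro!: add_mono length_topk)

lemma length_cands: "length (cands k F) \<le> k * k + 2 * k"
proof -
  define D where "D = filter (\<lambda>b. \<not> upward b) F"
  have "length (row_cands k (filter upward F) D) \<le> k + k"
    unfolding row_cands_def by (auto simp: Let_def split: list.split intro!: add_mono length_topk)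
  moreover have "length (grid_cands k D (box_topk 0 k D)) \<le> k * k"
    using length_grid_cands[of k D "box_topk 0 k D"] length_topk[of "box_le 0" "box_key 0" k D]
    by (meson le_trans mult_le_mono1)
  ultimately show ?thesis
    by (simp add: cands_def D_def Let_def)
qed

lemma cands_subset: "set (cands k F) \<subseteq> set F"
  using topk_subset
  by (fastforce simp: cands_def row_cands_def grid_cands_def Let_def split: list.splits)

text \<open>If \<open>w\<close> already belongs to \<open>S\<close>, then \<open>w\<close> itself is
  taken out and \<open>p\<close> stays; hence the clash condition is asked only for
  \<open>w \<notin> S\<close>.\<close>

lemma exchangeI:
  assumes "inj_on bid F" "w \<in> F" "S \<subseteq> F" "stable S" "p \<in> S" "finite S"
    and "w \<notin> S \<Longrightarrow> \<forall>q\<in>S - {p}. \<not> clash w q"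
  shows "\<exists>S' \<subseteq> {q\<in>F. compatible w q}. stable S' \<and> Suc (card S') = card S"
proof -
  define T where "T = S - {if w \<in> S then w else p}"
  have "compatible w q" if "q \<in> T" for q
    using that assms unfolding T_def compatible_def inj_on_def stable_def
    by (auto split: if_splits)
  moreover have "Suc (card T) = card S"
    using assms(5,6) unfolding T_def by (metis (full_types) card_Suc_Diff1)
  moreover have "stable T" "T \<subseteq> F"
    using assms stable_subset[of S T] by (auto simp: T_def)
  ultimately show ?thesis by blast
qed

text \<open>Let \<open>r\<close> be the highest row with a corner of \<open>S\<close>, and \<open>s\<close> the highest row with the corner of an
  upward box.  If \<open>r < s\<close>, then every upward box in row \<open>s\<close> clashes with at most one member of \<open>S\<close>,
  because all these members contain the grid edge above its corner.  Otherwise let \<open>p\<close> be the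
  rightmost member of \<open>S\<close> in row \<open>r\<close>, so that nothing in this row obstructs a box starting further
  right.  If \<open>r = s\<close>, it is replaced by a box in the same row; if \<open>r > s\<close>, then \<open>p\<close> goes down
  and no arm of \<open>S\<close> goes up from row \<open>r\<close>, so it may also move upwards within its column.\<close>

lemma cands_exchange:
  assumes ok: "\<forall>b\<in>set F. box_ok b" and inj: "inj_on bid (set F)"
    and S: "S \<subseteq> set F" "stable S" "card S = Suc k"
  shows "\<exists>w\<in>set (cands (Suc k) F). \<exists>S' \<subseteq> {q\<in>set F. compatible w q}. stable S' \<and> card S' = k"
proof -
  have fin: "finite S" and ne: "S \<noteq> {}" using S by (auto intro: finite_subset)
  define D where "D = filter (\<lambda>b. \<not> upward b) F"
  define U where "U = filter upward F"
  define r where "r = Max (cy ` S)"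
  have rmax: "cy q \<le> r" if "q \<in> S" for q using that fin by (simp add: r_def)
  have rin: "\<exists>p\<in>S. cy p = r" using Max_in[of "cy ` S"] fin ne unfolding r_def by (metis (no_types, lifting) finite_imageI imageE image_is_empty)
  have okS: "box_ok q" if "q \<in> S" for q using that ok S by auto
  obtain p where p: "p \<in> S" "cy p = r"
    and free: "\<And>q. q \<in> S - {p} \<Longrightarrow> cy q = r \<Longrightarrow> hl q = hr q \<or> hr q \<le> hl p"
  \<comment> \<open>Rightmost is judged among boxes with a nonempty horizontal arm: a box without
    one may sit in the interior of another arm and does not bound that arm on the right.\<close>
  proof (cases "\<forall>q\<in>S. cy q = r \<longrightarrow> hl q = hr q")
    case True
    then show ?thesis using rin that by blast
  next
    case False
    define N where "N = {q\<in>S. cy q = r \<and> hl q \<noteq> hr q}"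
    have N: "finite N" "N \<noteq> {}" using fin False by (auto simp: N_def)
    obtain p where p: "p \<in> N" "\<And>q. q \<in> N \<Longrightarrow> hl q \<le> hl p"
      using obtains_MAX[OF N, of hl] Max_ge[OF finite_imageI[OF N(1), of hl]]
      by (metis imageI)
    show ?thesis
    proof (rule that[of p])
      fix q assume q: "q \<in> S - {p}" "cy q = r"
      show "hl q = hr q \<or> hr q \<le> hl p"
      proof (rule ccontr)
        assume "\<not> ?thesis"
        then have qN: "q \<in> N" "hl p < hr q" using q by (auto simp: N_def)
        then have "hl q \<le> hl p" "hl p < hr p" "cy p = cy q"
          using p q okS[of p] by (auto simp: N_def box_ok_def)
        \<comment> \<open>Both arms contain the edge to the right of \<open>hl p\<close>.\<close>
        then have "clash p q" using qN by (auto simp: clash_def)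
        then show False using q p S unfolding stable_def N_def by auto
      qed
    qed (use p in \<open>auto simp: N_def\<close>)
  qed
  have exch: ?thesis if "w \<in> set (cands (Suc k) F)" "p' \<in> S"
    "w \<notin> S \<Longrightarrow> \<forall>q\<in>S - {p'}. \<not> clash w q" for w p'
    using exchangeI[OF inj _ S(1,2) that(2) fin that(3)] that(1) cands_subset S(3)
    by (metis nat.inject subsetD)
  have norow: "\<not> max (hl w) (hl q) < min (hr w) (hr q)"
    if "hl p \<le> hl w" "q \<in> S - {p}" "cy q = r" for w q
    using free[of q] that by auto
  have cands_eq: "cands (Suc k) F = row_cands (Suc k) U D @
      grid_cands (Suc k) D (box_topk 0 (Suc k) D)"
    by (simp add: cands_def D_def U_def Let_def)
  have grid: ?thesis if nup: "\<not> upward p" and above: "\<And>q. q \<in> S \<Longrightarrow> upward q \<Longrightarrow> cy q < r"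
  proof -
    have pD: "p \<in> set D" using nup p S by (auto simp: D_def)
    have oD: "box_ok b" "\<not> upward b" if "b \<in> set D" for b
      using that ok by (auto simp: D_def)
    obtain c where c: "c \<in> set (box_topk 0 (Suc k) D)" "box_le 0 p c"
      "cx c = cx p \<or> cx c \<notin> cx ` (S - {p})"
      by (rule box_topk_exchange[OF pD fin p(1) S(3) box_key_simps(1)])
    have cD: "c \<in> set D" using c topk_subset by fast
    define G where "G = filter (\<lambda>q. cx q = cx c) D"
    have sub: "w \<in> set (cands (Suc k) F)" if "w \<in> set (box_topk 2 (Suc k) G)" for w
      using that c(1) by (auto simp: cands_eq grid_cands_def G_def)
    show ?thesis
    proof (cases "cx c = cx p")
      case True
      then have pG: "p \<in> set G" using pD by (auto simp: G_def)
      obtain w where w: "w \<in> set (box_topk 2 (Suc k) G)" "box_le 2 p w"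
        "cy w = cy p \<or> cy w \<notin> cy ` (S - {p})"
        by (rule box_topk_exchange[OF pG fin p(1) S(3) box_key_simps(3)])
      have wG: "w \<in> set G" using w topk_subset by fast
      then have ww: "cx w = cx p" "box_ok w" "\<not> upward w" "vl p \<le> vl w"
        using oD w True by (auto simp: G_def box_le_def)
      have xs: "cx w = hl w" "cx p = hl p" "cy w = vr w" "cy p = vr p" "vl p < vr p"
        using ww okS[OF p(1)] nup by (auto simp: box_ok_def upward_def)
      have "\<not> clash w q" if q: "q \<in> S - {p}" for q
      proof
        assume "clash w q"
        moreover have "\<not> (cy w = cy q \<and> max (hl w) (hl q) < min (hr w) (hr q))"
          using w(3) norow[of w q] q xs ww p by force
        ultimately have cl: "cx w = cx q" "max (vl w) (vl q) < min (vr w) (vr q)"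
          by (auto simp: clash_def)
        have "\<not> clash p q" using S(2) q p by (auto simp: stable_def)
        then have n: "\<not> max (vl p) (vl q) < min (vr p) (vr q)"
          using cl ww by (auto simp: clash_def)
        have "box_ok q" "cy q \<le> r" using q okS rmax by auto
        \<comment> \<open>Since \<open>w\<close> reaches no lower than \<open>p\<close>, a member
          that meets \<open>w\<close> but not \<open>p\<close> lies above row \<open>r\<close> in
          this column. Its corner is not above \<open>r\<close>, so it goes up from
          \<open>r\<close>, against \<open>above\<close>.\<close>
        moreover have "vr p \<le> vl q" using n cl ww xs by auto
        ultimately show False
          using above[of q] q cl xs p unfolding box_ok_def upward_def by auto
      qed
      then show ?thesis using exch[OF sub[OF w(1)] p(1)] by blast
    next
      case False
      then have free_col: "cx c \<notin> cx ` (S - {p})" using c by auto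
      have cG: "c \<in> set G" using cD by (auto simp: G_def)
      obtain w where w: "w \<in> set (box_topk 2 (Suc k) G)"
        "cy w = cy c \<or> cy w \<notin> cy ` (S - {p})"
      \<comment> \<open>The column of \<open>c\<close> is free, so vertical arms do not matter and
        only rows are counted: either the row of \<open>c\<close> is selected, or one of
        \<open>Suc k\<close> distinct rows avoids \<open>S - {p}\<close>.\<close>
      proof (cases "\<exists>w\<in>set (box_topk 2 (Suc k) G). cy w = cy c")
        case True
        then show ?thesis using that by blast
      next
        case no: False
        have "card (cy ` set (box_topk 2 (Suc k) G)) = Suc k"
          using box_topk_dominates[OF cG, of 2 "Suc k"] no by (simp add: box_key_simps)
        moreover have "card (cy ` (S - {p})) < Suc k"
          using S(3) p(1) fin card_image_le[of "S - {p}" cy] by simp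
        ultimately have "\<not> cy ` set (box_topk 2 (Suc k) G) \<subseteq> cy ` (S - {p})"
          using card_mono[OF finite_imageI[OF finite_Diff[OF fin]]] by (metis leD)
        then show ?thesis using that by blast
      qed
      have wG: "w \<in> set G" using w topk_subset by fast
      then have ww: "cx w = cx c" "box_ok w" "\<not> upward w" "box_ok c" "\<not> upward c"
        using oD cD by (auto simp: G_def)
      have xs: "cx w = hl w" "cx c = hl c" "cx p = hl p"
        using ww okS[OF p(1)] nup by (auto simp: box_ok_def)
      have "\<not> clash w q" if q: "q \<in> S - {p}" for q
      proof -
        have "cx w \<noteq> cx q" using free_col q ww by auto
        moreover have "\<not> (cy w = cy q \<and> max (hl w) (hl q) < min (hr w) (hr q))"
        proof
          assume a: "cy w = cy q \<and> max (hl w) (hl q) < min (hr w) (hr q)"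
          then have "cy q = cy c" using w(2) q by auto
          then have "cy q = r" "hl p \<le> hl w"
            using c(2) p rmax[of q] q ww xs by (auto simp: box_le_def)
          then show False using norow[of w q] q a by blast
        qed
        ultimately show ?thesis by (auto simp: clash_def)
      qed
      then show ?thesis using exch[OF sub[OF w(1)] p(1)] by blast
    qed
  qed
  show ?thesis
  proof (cases U)
    case Nil
    then have "\<not> upward q" if "q \<in> S" for q
      using that S by (auto simp: U_def filter_empty_conv)
    then show ?thesis using grid p by blast
  next
    case (Cons x xs)
    define u where "u = best (box_le 0) x xs"
    define s where "s = cy u"
    have uU: "u \<in> set U" using best_in[of "box_le 0" x xs] Cons by (simp add: u_def)
    have smax: "cy b \<le> s" if "b \<in> set F" "upward b" for b
    proof -
      have "b \<in> set U" using that by (simp add: U_def)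
      then have "b \<in> insert x (set xs)" using Cons by simp
      then have "box_le 0 b u" unfolding u_def by (rule best_box_ge)
      then show ?thesis by (auto simp: s_def box_le_def)
    qed
    define Us where "Us = filter (\<lambda>q. cy q = s) U"
    define Ds where "Ds = filter (\<lambda>q. cy q = s) D"
    have rc: "set (box_topk 1 (Suc k) Us) \<subseteq> set (cands (Suc k) F)"
        "set (box_topk 1 (Suc k) Ds) \<subseteq> set (cands (Suc k) F)"
      using Cons by (auto simp: cands_eq row_cands_def u_def s_def Us_def Ds_def Let_def)
    have Us: "upward w" "cy w = s" "box_ok w" if "w \<in> set (box_topk 1 (Suc k) Us)" for w
      using that topk_subset[of "box_le 1" "box_key 1" "Suc k" Us] ok by (auto simp: Us_def U_def)
    consider "r < s" | "r = s" | "s < r" by linarith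
    then show ?thesis
    proof cases
      case 1
      have "u \<in> set Us" using uU by (simp add: Us_def s_def)
      then obtain w where w: "w \<in> set (box_topk 1 (Suc k) Us)"
        using topk_ne_Nil[of "box_le 1" "box_key 1" "Suc k" Us] by (cases "box_topk 1 (Suc k) Us") auto
      note ww = Us[OF w]
      have through: "cx q = cx w \<and> vl q \<le> s \<and> s < vr q" if "q \<in> S" "clash w q" for q
        using that ww rmax[OF that(1)] 1 okS[OF that(1)]
        by (auto simp: clash_def upward_def box_ok_def)
      have "\<exists>p'\<in>S. \<forall>q\<in>S - {p'}. \<not> clash w q"
      proof (cases "\<exists>p'\<in>S. clash w p'")
        case True
        then obtain p' where p': "p' \<in> S" "clash w p'" by blast
        have "\<not> clash w q" if q: "q \<in> S - {p'}" for q
        proof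
          assume "clash w q"
          then have "clash q p'"
            using through[of q] through[OF p'] q by (simp add: clash_def)
          then show False using S(2) q p'(1) by (auto simp: stable_def)
        qed
        then show ?thesis using p' by blast
      qed (use p in blast)
      then show ?thesis using exch rc w by blast
    next
      case 2
      show ?thesis
      proof (cases "upward p")
        case True
        then have pU: "p \<in> set Us" using p S 2 by (auto simp: Us_def U_def)
        obtain w where w: "w \<in> set (box_topk 1 (Suc k) Us)" "box_le 1 p w"
          "cx w = cx p \<or> cx w \<notin> cx ` (S - {p})"
          by (rule box_topk_exchange[OF pU fin p(1) S(3) box_key_simps(2)])
        note ww = Us[OF w(1)]
        have okp: "box_ok p" using p okS by auto
        have hlw: "hl p \<le> hl w" using w by (auto simp: box_le_def)
        have "\<not> clash w q" if q: "q \<in> S - {p}" for q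
        proof
          assume "clash w q"
          moreover have "\<not> (cy w = cy q \<and> max (hl w) (hl q) < min (hr w) (hr q))"
            using norow[of w q] hlw q ww 2 by auto
          ultimately have cl: "cx w = cx q" "max (vl w) (vl q) < min (vr w) (vr q)"
            by (auto simp: clash_def)
          then have xw: "cx w = cx p" using w(3) q by auto
          have vw: "cy w = vl w" "cy p = vl p" using ww True okp by (auto simp: upward_def box_ok_def)
          have q': "cy q \<le> s" "box_ok q" using q rmax 2 okS by auto
          have "vl q \<le> s" using q' by (auto simp: box_ok_def)
          \<comment> \<open>Without a vertical arm, \<open>p\<close> would have its corner at its
            left end. Then \<open>w\<close>, in the same column, would have the same left end, and
            the tie-break of order 1 would deny it a vertical arm as well.\<close>
          have "vl p < vr p"
          proof (rule ccontr)
            assume "\<not> vl p < vr p"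
            then have e: "vl p = vr p" "cx p = hl p" using okp by (auto simp: box_ok_def)
            then have "hl w = hl p" using hlw xw ww by (auto simp: box_ok_def)
            then have "vr w \<le> vl w" using w(2) e by (auto simp: box_le_def)
            then show False using cl by auto
          qed
          then have "clash p q"
            using cl xw vw ww \<open>vl q \<le> s\<close> p 2 by (auto simp: clash_def)
          then show False using S(2) q p by (auto simp: stable_def)
        qed
        then show ?thesis using exch[OF subsetD[OF rc(1) w(1)] p(1)] by blast
      next
        case False
        then have pU: "p \<in> set Ds" using p S 2 by (auto simp: Ds_def D_def)
        obtain w where w: "w \<in> set (box_topk 1 (Suc k) Ds)" "box_le 1 p w"
          "cx w = cx p \<or> cx w \<notin> cx ` (S - {p})"
          by (rule box_topk_exchange[OF pU fin p(1) S(3) box_key_simps(2)])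
        have ww: "\<not> upward w" "cy w = s" "box_ok w"
          using w(1) topk_subset[of "box_le 1" "box_key 1" "Suc k" Ds] ok by (auto simp: Ds_def D_def)
        have okp: "box_ok p" using p okS by auto
        have xs: "cx w = hl w" "cx p = hl p" "cy w = vr w" "cy p = vr p"
          using ww okp False by (auto simp: box_ok_def upward_def)
        have hlw: "hl p \<le> hl w" using w by (auto simp: box_le_def)
        have "\<not> clash w q" if q: "q \<in> S - {p}" for q
        proof
          assume "clash w q"
          moreover have "\<not> (cy w = cy q \<and> max (hl w) (hl q) < min (hr w) (hr q))"
            using norow[of w q] hlw q ww 2 by auto
          ultimately have cl: "cx w = cx q" "max (vl w) (vl q) < min (vr w) (vr q)"
            by (auto simp: clash_def)
          then have xw: "cx w = cx p" using w(3) q by auto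
          \<comment> \<open>Downward boxes in one column share their left end, so the tie-break of
            order 1 applies.\<close>
          then have "vr w - vl w \<le> vr p - vl p" using w(2) xs by (auto simp: box_le_def)
          moreover have "vr w = vr p" using xs ww p 2 by auto
          ultimately have "vl p \<le> vl w" using okp ww by (auto simp: box_ok_def)
          then have "clash p q"
            using cl xw \<open>vr w = vr p\<close> by (auto simp: clash_def)
          then show False using S(2) q p by (auto simp: stable_def)
        qed
        then show ?thesis using exch[OF subsetD[OF rc(2) w(1)] p(1)] by blast
      qed
    next
      \<comment> \<open>No upward corner lies above \<open>s\<close>, so \<open>p\<close> goes down
        and every upward member of \<open>S\<close> has its corner strictly below
        \<open>r\<close>.\<close>
      case 3
      then show ?thesis
        using grid p smax S by (metis leD order_le_less_trans subsetD)
    qed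
  qed
qed

section \<open>The branching recursion\<close>

fun search :: "nat \<Rightarrow> box list \<Rightarrow> bool" where
  "search 0 F = True"
| "search (Suc k) F = (\<exists>w\<in>set (cands (Suc k) F). search k (filter (compatible w) F))"

text \<open>No particular solution has to be preserved: it is enough that some solution with one
  member less survives among the boxes compatible with a candidate.\<close>

lemma search_iff:
  assumes "\<forall>b\<in>set F. box_ok b" "inj_on bid (set F)"
  shows "search k F \<longleftrightarrow> (\<exists>S\<subseteq>set F. stable S \<and> card S = k)"
  using assms
proof (induction k arbitrary: F)
  case 0
  have "\<exists>S\<subseteq>set F. stable S \<and> card S = 0"
    by (rule exI[of _ "{}"]) (auto simp: stable_def)
  then show ?case by simp
next
  case (Suc k)
  have IH: "search k (filter (compatible w) F) \<longleftrightarrow>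
      (\<exists>S\<subseteq>{q\<in>set F. compatible w q}. stable S \<and> card S = k)" for w
    using Suc.IH[of "filter (compatible w) F"] Suc.prems by (auto simp: inj_on_def)
  show ?case
  proof
    assume "search (Suc k) F"
    then obtain w S where w: "w \<in> set F" "S \<subseteq> {q\<in>set F. compatible w q}" "stable S" "card S = k"
      using IH cands_subset by fastforce
    then have "finite S" "w \<notin> S" by (auto simp: compatible_def intro: finite_subset)
    moreover have "stable (insert w S)"
      using w clash_commute unfolding stable_def compatible_def by blast
    ultimately show "\<exists>S\<subseteq>set F. stable S \<and> card S = Suc k"
      using w by (intro exI[of _ "insert w S"]) auto
  next
    assume "\<exists>S\<subseteq>set F. stable S \<and> card S = Suc k"
    then show "search (Suc k) F"
      using cands_exchange[OF Suc.prems] IH by auto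
  qed
qed


section \<open>A program for the branching algorithm\<close>

definition evb :: "program \<Rightarrow> val list \<Rightarrow> expr \<Rightarrow> val \<Rightarrow> nat \<Rightarrow> bool" where
  "evb p env e v t \<longleftrightarrow> (\<exists>t'\<le>t. eval p env e v t')"

definition computes :: "program \<Rightarrow> nat \<Rightarrow> val \<Rightarrow> val \<Rightarrow> nat \<Rightarrow> bool" where
  "computes p f v r t \<longleftrightarrow> f < length p \<and> evb p [v] (p ! f) r t"

lemma evbI: "eval p env e v t' \<Longrightarrow> t' \<le> t \<Longrightarrow> evb p env e v t"
  by (auto simp: evb_def)

text \<open>Applied backwards, this turns value and bound into unknowns, which the evaluation rules
  instantiate by following the expression. It remains to see that the value found is the intended
  one and that the bound suffices.\<close>

lemma evb_mono: "evb p env e v t \<Longrightarrow> v = v' \<Longrightarrow> t \<le> t' \<Longrightarrow> evb p env e v' t'"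
  by (auto simp: evb_def intro: le_trans)

lemma computes_mono: "computes p f v r t \<Longrightarrow> r = r' \<Longrightarrow> t \<le> t' \<Longrightarrow> computes p f v r' t'"
  by (auto simp: computes_def intro: evb_mono)

lemma evb_Var: "i < length env \<Longrightarrow> evb p env (Var i) (env ! i) 1"
  by (rule evbI[OF eval.Var]) auto

lemma evb_Vars:
  "evb p (a # env) (Var 0) a 1"
  "evb p (a # b # env) (Var 1) b 1"
  "evb p (a # b # c # env) (Var 2) c 1"
  "evb p (a # b # c # d # env) (Var 3) d 1"
  "evb p (a # b # c # d # e # env) (Var 4) e 1"
  using evb_Var[of 0 "a # env"] evb_Var[of 1 "a # b # env"] evb_Var[of 2 "a # b # c # env"]
    evb_Var[of 3 "a # b # c # d # env"] evb_Var[of 4 "a # b # c # d # e # env"]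
  by simp_all

lemma evb_Const: "evb p env (Const m) (Num m) 1"
  by (rule evbI[OF eval.Const]) auto

lemma evb_Mk:
  "evb p env e v t \<Longrightarrow> evb p env e' v' t' \<Longrightarrow> evb p env (Mk e e') (Node v v') (t + t' + 1)"
  unfolding evb_def using eval.Mk add_mono by (metis add_le_mono1)

lemma evb_Left: "evb p env e (Node v v') t \<Longrightarrow> evb p env (Left e) v (t + 1)"
  unfolding evb_def using eval.Left by (metis add_le_mono1)

lemma evb_Right: "evb p env e (Node v v') t \<Longrightarrow> evb p env (Right e) v' (t + 1)"
  unfolding evb_def using eval.Right by (metis add_le_mono1)

definition is_node :: "val \<Rightarrow> bool" where
  "is_node v \<longleftrightarrow> (\<exists>l r. v = Node l r)"

lemma evb_IsNode: "evb p env e v t \<Longrightarrow> evb p env (IsNode e) (Num (of_bool (is_node v))) (t + 1)"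
  unfolding evb_def is_node_def of_bool_def using eval.IsNode
  by (metis (no_types, lifting) add_le_mono1 val_of_bool_def)

lemma evb_Sub: "evb p env e (Num m) t \<Longrightarrow> evb p env e' (Num m') t' \<Longrightarrow>
    evb p env (Sub e e') (Num (m - m')) (t + t' + 1)"
  unfolding evb_def using eval.Sub add_mono by (metis add_le_mono1)

lemma evb_Leq: "evb p env e (Num m) t \<Longrightarrow> evb p env e' (Num m') t' \<Longrightarrow>
    evb p env (Leq e e') (Num (of_bool (m \<le> m'))) (t + t' + 1)"
  unfolding evb_def of_bool_def using eval.Leq add_mono by (metis add_le_mono1 val_of_bool_def)

lemma evb_CondT: "evb p env e (Num m) t \<Longrightarrow> m \<noteq> 0 \<Longrightarrow> evb p env e1 v t' \<Longrightarrow>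
    evb p env (Cond e e1 e2) v (t + t' + 1)"
proof -
  assume m: "m \<noteq> 0" and "evb p env e (Num m) t" "evb p env e1 v t'"
  then obtain s s' where s: "eval p env e (Num m) s" "s \<le> t" "eval p env e1 v s'" "s' \<le> t'"
    by (auto simp: evb_def)
  show ?thesis
    by (rule evbI[OF eval.Cond[OF s(1), of e1 e2 v s']]) (use m s in auto)
qed

lemma evb_CondF: "evb p env e (Num m) t \<Longrightarrow> m = 0 \<Longrightarrow> evb p env e2 v t' \<Longrightarrow>
    evb p env (Cond e e1 e2) v (t + t' + 1)"
proof -
  assume m: "m = 0" and "evb p env e (Num m) t" "evb p env e2 v t'"
  then obtain s s' where s: "eval p env e (Num m) s" "s \<le> t" "eval p env e2 v s'" "s' \<le> t'"
    by (auto simp: evb_def)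
  show ?thesis
    by (rule evbI[OF eval.Cond[OF s(1), of e1 e2 v s']]) (use m s in auto)
qed

text \<open>Both branches must have a value here. Where the branch not taken may be stuck, as with
  the head of an empty list, \<open>evb_CondT\<close> and \<open>evb_CondF\<close> are used.\<close>

lemma evb_Cond: "evb p env e (Num (of_bool P)) t \<Longrightarrow> evb p env e1 v1 t1 \<Longrightarrow> evb p env e2 v2 t2 \<Longrightarrow>
    evb p env (Cond e e1 e2) (if P then v1 else v2) (t + max t1 t2 + 1)"
  by (cases P) (auto intro: evb_mono[OF evb_CondT] evb_mono[OF evb_CondF])

lemma evb_Bind: "evb p env e v t \<Longrightarrow> evb p (v # env) e' v' t' \<Longrightarrow>
    evb p env (Bind e e') v' (t + t' + 1)"
  unfolding evb_def using eval.Bind add_mono by (metis add_le_mono1)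

lemma evb_Call: "evb p env e v t \<Longrightarrow> computes p f v v' t' \<Longrightarrow>
    evb p env (Call f e) v' (t + t' + 1)"
  unfolding evb_def computes_def using eval.Call add_mono by (metis add_le_mono1)

text \<open>The connectives are constants of their own so that their rules, and not
  \<open>evb_Cond\<close>, apply to them; the values then keep the form
  \<open>Num (of_bool _)\<close>.\<close>

definition "AndE a b = Cond a b (Const 0)"
definition "OrE a b = Cond a (Const 1) b"
definition "NotE a = Cond a (Const 0) (Const 1)"
definition "EqE a b = AndE (Leq a b) (Leq b a)"
definition "LtE a b = NotE (Leq b a)"
definition "MinE a b = Cond (Leq a b) a b"
definition "MaxE a b = Cond (Leq a b) b a"

lemma evb_AndE: "evb p env a (Num (of_bool P)) t \<Longrightarrow> evb p env b (Num (of_bool Q)) t' \<Longrightarrow>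
    evb p env (AndE a b) (Num (of_bool (P \<and> Q))) (t + t' + 2)"
  unfolding AndE_def by (rule evb_mono[OF evb_Cond[OF _ _ evb_Const]]) auto

lemma evb_OrE: "evb p env a (Num (of_bool P)) t \<Longrightarrow> evb p env b (Num (of_bool Q)) t' \<Longrightarrow>
    evb p env (OrE a b) (Num (of_bool (P \<or> Q))) (t + t' + 2)"
  unfolding OrE_def by (rule evb_mono[OF evb_Cond[OF _ evb_Const]]) auto

lemma evb_NotE: "evb p env a (Num (of_bool P)) t \<Longrightarrow>
    evb p env (NotE a) (Num (of_bool (\<not> P))) (t + 2)"
  unfolding NotE_def by (rule evb_mono[OF evb_Cond[OF _ evb_Const evb_Const]]) auto

lemma evb_EqE: "evb p env a (Num m) t \<Longrightarrow> evb p env b (Num m') t' \<Longrightarrow>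
    evb p env (EqE a b) (Num (of_bool (m = m'))) (2 * t + 2 * t' + 4)"
  unfolding EqE_def by (rule evb_mono[OF evb_AndE[OF evb_Leq evb_Leq]]) auto

lemma evb_LtE: "evb p env a (Num m) t \<Longrightarrow> evb p env b (Num m') t' \<Longrightarrow>
    evb p env (LtE a b) (Num (of_bool (m < m'))) (t + t' + 3)"
  unfolding LtE_def by (rule evb_mono[OF evb_NotE[OF evb_Leq]]) auto

lemma evb_MinE: "evb p env a (Num m) t \<Longrightarrow> evb p env b (Num m') t' \<Longrightarrow>
    evb p env (MinE a b) (Num (min m m')) (2 * t + 2 * t' + 2)"
  unfolding MinE_def by (rule evb_mono[OF evb_Cond[OF evb_Leq]]) (auto simp: min_def)

lemma evb_MaxE: "evb p env a (Num m) t \<Longrightarrow> evb p env b (Num m') t' \<Longrightarrow>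
    evb p env (MaxE a b) (Num (max m m')) (2 * t + 2 * t' + 2)"
  unfolding MaxE_def by (rule evb_mono[OF evb_Cond[OF evb_Leq]]) (auto simp: max_def)

section \<open>Boxes as trees, and the text of the program\<close>

definition val_of_box :: "box \<Rightarrow> val" where
  "val_of_box b = Node (Num (bid b)) (Node (Num (cx b)) (Node (Num (cy b))
     (Node (Num (hl b)) (Node (Num (hr b)) (Node (Num (vl b)) (Num (vr b)))))))"

definition "BidE e = Left e"
definition "CxE e = Left (Right e)"
definition "CyE e = Left (Right (Right e))"
definition "HlE e = Left (Right (Right (Right e)))"
definition "HrE e = Left (Right (Right (Right (Right e))))"
definition "VlE e = Left (Right (Right (Right (Right (Right e)))))"
definition "VrE e = Right (Right (Right (Right (Right (Right e)))))"
definition "BoxE a b c d e f g = Mk a (Mk b (Mk c (Mk d (Mk e (Mk f g)))))"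

lemma evb_fields:
  assumes "evb p env e (val_of_box b) t"
  shows "evb p env (BidE e) (Num (bid b)) (t + 6)" "evb p env (CxE e) (Num (cx b)) (t + 6)"
    "evb p env (CyE e) (Num (cy b)) (t + 6)" "evb p env (HlE e) (Num (hl b)) (t + 6)"
    "evb p env (HrE e) (Num (hr b)) (t + 6)" "evb p env (VlE e) (Num (vl b)) (t + 6)"
    "evb p env (VrE e) (Num (vr b)) (t + 6)"
  using assms unfolding BidE_def CxE_def CyE_def HlE_def HrE_def VlE_def VrE_def val_of_box_def
  by - (rule evb_mono, (assumption | rule evb_Left evb_Right)+; simp)+

lemma evb_BoxE:
  assumes "evb p env e1 (Num n1) t1" "evb p env e2 (Num n2) t2" "evb p env e3 (Num n3) t3"
    "evb p env e4 (Num n4) t4" "evb p env e5 (Num n5) t5" "evb p env e6 (Num n6) t6"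
    "evb p env e7 (Num n7) t7"
  shows "evb p env (BoxE e1 e2 e3 e4 e5 e6 e7) (val_of_box (Box n1 n2 n3 n4 n5 n6 n7))
    (t1 + t2 + t3 + t4 + t5 + t6 + t7 + 6)"
  unfolding BoxE_def by (rule evb_mono, (rule assms evb_Mk)+) (auto simp: val_of_box_def)

lemmas evb_intros = evb_Vars evb_Const evb_Mk evb_Left evb_Right evb_IsNode evb_Sub evb_Leq evb_Cond
  evb_Bind evb_Call evb_AndE evb_OrE evb_NotE evb_EqE evb_LtE evb_MinE evb_MaxE evb_fields evb_BoxE

definition boxes :: "box list \<Rightarrow> val" where
  "boxes bs = val_of_list (map val_of_box bs)"

lemma boxes_simps: "boxes [] = Num 0" "boxes (b # bs) = Node (val_of_box b) (boxes bs)"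
  by (simp_all add: boxes_def)

lemma is_node_simps [simp]: "is_node (Node l r)" "\<not> is_node (Num m)"
  by (auto simp: is_node_def)

text \<open>For \<open>m \<le> 2\<close> the test compares keys: its \<open>m\<close> is that of \<open>box_key\<close>.\<close>

definition box_test :: "nat \<Rightarrow> box \<Rightarrow> box \<Rightarrow> bool" where
  "box_test m w q = (if m \<le> 1 then cx q \<noteq> cx w else if m = 2 then cy q \<noteq> cy w
     else if m = 3 then upward q else if m = 4 then \<not> upward q
     else if m = 5 then cy q = cy w else if m = 6 then cx q = cx w else compatible w q)"

abbreviation "Arg1 \<equiv> Left (Var 0)"
abbreviation "Arg2 \<equiv> Left (Right (Var 0))"
abbreviation "Arg3 \<equiv> Right (Right (Var 0))"

definition clashE :: "expr \<Rightarrow> expr \<Rightarrow> expr" where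
  "clashE p q = OrE
     (AndE (EqE (CyE p) (CyE q)) (LtE (MaxE (HlE p) (HlE q)) (MinE (HrE p) (HrE q))))
     (AndE (EqE (CxE p) (CxE q)) (LtE (MaxE (VlE p) (VlE q)) (MinE (VrE p) (VrE q))))"

definition test_body :: expr where
  "test_body =
     Cond (Leq Arg1 (Const 1)) (NotE (EqE (CxE Arg3) (CxE Arg2)))
    (Cond (EqE Arg1 (Const 2)) (NotE (EqE (CyE Arg3) (CyE Arg2)))
    (Cond (EqE Arg1 (Const 3)) (Leq (CyE Arg3) (VlE Arg3))
    (Cond (EqE Arg1 (Const 4)) (NotE (Leq (CyE Arg3) (VlE Arg3)))
    (Cond (EqE Arg1 (Const 5)) (EqE (CyE Arg3) (CyE Arg2))
    (Cond (EqE Arg1 (Const 6)) (EqE (CxE Arg3) (CxE Arg2))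
      (AndE (NotE (clashE Arg2 Arg3)) (NotE (EqE (BidE Arg3) (BidE Arg2)))))))))"

definition filter_body :: expr where
  "filter_body = Cond (IsNode Arg3)
     (Bind (Call 2 (Mk Arg1 (Mk Arg2 (Right Arg3))))
       (Cond (Call 1 (Mk (Left (Var 1)) (Mk (Left (Right (Var 1))) (Left (Right (Right (Var 1)))))))
         (Mk (Left (Right (Right (Var 1)))) (Var 0)) (Var 0)))
     (Const 0)"

definition le_body :: expr where
  "le_body = Cond (Leq Arg1 (Const 0))
     (OrE (LtE (CyE Arg2) (CyE Arg3)) (AndE (EqE (CyE Arg2) (CyE Arg3)) (Leq (CxE Arg2) (CxE Arg3))))
    (Cond (EqE Arg1 (Const 1))
     (OrE (LtE (HlE Arg2) (HlE Arg3)) (AndE (EqE (HlE Arg2) (HlE Arg3))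
        (Leq (Sub (VrE Arg3) (VlE Arg3)) (Sub (VrE Arg2) (VlE Arg2)))))
     (Leq (VlE Arg2) (VlE Arg3)))"

definition best_body :: expr where
  "best_body = Cond (IsNode Arg3)
     (Call 4 (Mk Arg1 (Mk (Cond (Call 3 (Mk Arg1 (Mk Arg2 (Left Arg3)))) (Left Arg3) Arg2)
        (Right Arg3)))) Arg2"

definition topk_body :: expr where
  "topk_body = Cond (AndE (Leq (Const 1) Arg2) (IsNode Arg3))
     (Bind (Call 4 (Mk Arg1 Arg3))
       (Mk (Var 0) (Call 5 (Mk (Left (Var 1)) (Mk (Sub (Left (Right (Var 1))) (Const 1))
          (Call 2 (Mk (Left (Var 1)) (Mk (Var 0) (Right (Right (Var 1))))))))))) (Const 0)"

definition append_body :: expr where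
  "append_body = Cond (IsNode Arg1)
     (Mk (Left Arg1) (Call 6 (Mk (Right Arg1) (Right (Var 0))))) (Right (Var 0))"

definition grid_body :: expr where
  "grid_body = Cond (IsNode Arg3)
     (Call 6 (Mk (Call 5 (Mk (Const 2) (Mk Arg1 (Call 2 (Mk (Const 6) (Mk (Left Arg3) Arg2))))))
        (Call 7 (Mk Arg1 (Mk Arg2 (Right Arg3)))))) (Const 0)"

definition dummyE :: expr where
  "dummyE = BoxE (Const 0) (Const 0) (Const 0) (Const 0) (Const 0) (Const 0) (Const 0)"

text \<open>In the scope of the bindings, variables 0, 1, 2 are the upward boxes, the other boxes
  and the argument.\<close>

definition cands_body :: expr where
  "cands_body =
     Bind (Call 2 (Mk (Const 4) (Mk dummyE (Right (Var 0)))))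
    (Bind (Call 2 (Mk (Const 3) (Mk dummyE (Right (Var 1)))))
    (Call 6 (Mk
       (Cond (IsNode (Var 0))
         (Bind (Call 4 (Mk (Const 0) (Var 0)))
           (Call 6 (Mk
             (Call 5 (Mk (Const 1) (Mk (Left (Var 3)) (Call 2 (Mk (Const 5) (Mk (Var 0) (Var 1)))))))
             (Call 5 (Mk (Const 1) (Mk (Left (Var 3)) (Call 2 (Mk (Const 5) (Mk (Var 0) (Var 2))))))))))
         (Const 0))
       (Call 7 (Mk (Left (Var 2)) (Mk (Var 1)
          (Call 5 (Mk (Const 0) (Mk (Left (Var 2)) (Var 1))))))))))"

definition search_body :: expr where
  "search_body = Cond (Leq Arg1 (Const 0)) (Const 1)
     (Call 10 (Mk Arg1 (Mk (Right (Var 0)) (Call 8 (Var 0)))))"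

definition try_body :: expr where
  "try_body = Cond (IsNode Arg3)
     (Cond (Call 9 (Mk (Sub Arg1 (Const 1)) (Call 2 (Mk (Const 7) (Mk (Left Arg3) Arg2)))))
       (Const 1) (Call 10 (Mk Arg1 (Mk Arg2 (Right Arg3))))) (Const 0)"

text \<open>A second name for \<open>Cond\<close>: \<open>evb_IteE\<close> moves the case
  distinction inside \<open>Num\<close>, where the rules for \<open>Sub\<close>, \<open>MinE\<close>
  and \<open>BoxE\<close> expect it.\<close>

definition "IteE e a b = Cond e a b"
definition "flipE i e = IteE (Left (Left (Left (Var i)))) (Sub (Left (Right (Left (Var i)))) e) e"
definition "flopE i e = IteE (Right (Left (Left (Var i)))) (Sub (Right (Right (Left (Var i)))) e) e"
definition "lastE e = Cond (IsNode (Right (Right e))) (Left (Right (Right e))) (Left (Right e))"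

abbreviation "PathE i \<equiv> Right (Right (Var i))"

text \<open>In the scope of the bindings, variables 0, 1, 2, 3 are the coordinates \<open>y'\<close>, \<open>x'\<close>, \<open>y\<close>, \<open>x\<close>
  of the end points of the path.\<close>

definition box_body :: expr where
  "box_body =
     Bind (flipE 0 (Left (Left (PathE 0))))
    (Bind (flopE 1 (Right (Left (PathE 1))))
    (Bind (flipE 2 (Left (lastE (PathE 2))))
    (Bind (flopE 3 (Right (lastE (PathE 3))))
    (BoxE (Left (Right (Var 4)))
      (IteE (IsNode (Right (Right (PathE 4))))
        (flipE 4 (Left (Left (Right (PathE 4))))) (MinE (Var 3) (Var 1)))
      (IteE (IsNode (Right (Right (PathE 4))))
        (flopE 4 (Right (Left (Right (PathE 4))))) (MinE (Var 2) (Var 0)))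
      (MinE (Var 3) (Var 1)) (MaxE (Var 3) (Var 1)) (MinE (Var 2) (Var 0)) (MaxE (Var 2) (Var 0))))))"

definition norm_body :: expr where
  "norm_body = Cond (IsNode (Right (Var 0)))
     (Bind (Call 12 (Mk (Left (Var 0)) (Right (Right (Var 0)))))
     (Bind (Call 11 (Mk (Left (Var 1)) (Left (Right (Var 1)))))
       (Cond (OrE (Leq (CyE (Var 0)) (VlE (Var 0))) (EqE (CxE (Var 0)) (HlE (Var 0))))
         (Mk (Var 0) (Var 1)) (Var 1)))) (Const 0)"

definition main_call :: "nat \<Rightarrow> nat \<Rightarrow> expr" where
  "main_call i j = Call 9 (Mk (Left (Var 0)) (Call 12
     (Mk (Mk (Mk (Const i) (Const j)) (Left (Right (Var 0)))) (Left (Right (Right (Var 0)))))))"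

definition main_body :: expr where
  "main_body = OrE (main_call 0 0) (OrE (main_call 0 1) (OrE (main_call 1 0) (main_call 1 1)))"

definition solver :: program where
  "solver = [main_body, test_body, filter_body, le_body, best_body, topk_body, append_body, grid_body,
     cands_body, search_body, try_body, box_body, norm_body]"

section \<open>Values and running times of the functions of the program\<close>

lemma computes_solverI:
  "evb solver [v] main_body r t \<Longrightarrow> computes solver 0 v r t"
  "evb solver [v] test_body r t \<Longrightarrow> computes solver 1 v r t"
  "evb solver [v] filter_body r t \<Longrightarrow> computes solver 2 v r t"
  "evb solver [v] le_body r t \<Longrightarrow> computes solver 3 v r t"
  "evb solver [v] best_body r t \<Longrightarrow> computes solver 4 v r t"
  "evb solver [v] topk_body r t \<Longrightarrow> computes solver 5 v r t"
  "evb solver [v] append_body r t \<Longrightarrow> computes solver 6 v r t"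
  "evb solver [v] grid_body r t \<Longrightarrow> computes solver 7 v r t"
  "evb solver [v] cands_body r t \<Longrightarrow> computes solver 8 v r t"
  "evb solver [v] search_body r t \<Longrightarrow> computes solver 9 v r t"
  "evb solver [v] try_body r t \<Longrightarrow> computes solver 10 v r t"
  "evb solver [v] box_body r t \<Longrightarrow> computes solver 11 v r t"
  "evb solver [v] norm_body r t \<Longrightarrow> computes solver 12 v r t"
  by (simp_all add: computes_def solver_def)

lemma evb_clashE:
  assumes "evb p env e (val_of_box b) t" "evb p env e' (val_of_box b') t'"
  shows "evb p env (clashE e e') (Num (of_bool (clash b b'))) (12 * t + 12 * t' + 200)"
  unfolding clashE_def
  by (rule evb_mono, (rule assms evb_intros)+) (auto simp: clash_def)

lemma computes_test:
  "computes solver 1 (Node (Num m) (Node (val_of_box w) (val_of_box q))) (Num (of_bool (box_test m w q))) 500"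
  apply (rule computes_solverI)
  unfolding test_body_def
  apply (rule evb_mono, (rule evb_clashE evb_intros)+)
  apply (simp add: box_test_def upward_def compatible_def)
  apply simp
  done

lemma computes_filter:
  "computes solver 2 (Node (Num m) (Node (val_of_box w) (boxes bs)))
     (boxes (filter (box_test m w) bs)) (600 * length bs + 10)"
proof (induction bs)
  case Nil
  show ?case
    apply (rule computes_solverI)
    unfolding filter_body_def boxes_simps
    apply (rule evb_mono, rule evb_CondF, (rule evb_intros)+)
    apply simp
    apply (rule evb_intros)
    by (simp_all add: boxes_simps)
next
  case (Cons b bs)
  show ?case
    apply (rule computes_solverI)
    unfolding filter_body_def boxes_simps
    apply (rule evb_mono, rule evb_CondT, (rule evb_intros)+)
    apply simp
    apply (rule computes_test Cons evb_intros)+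
    by (simp_all add: boxes_simps)
qed

lemma computes_le:
  "computes solver 3 (Node (Num m) (Node (val_of_box w) (val_of_box q))) (Num (of_bool (box_le m w q))) 300"
  apply (rule computes_solverI)
  unfolding le_body_def
  apply (rule evb_mono, (rule evb_intros)+)
  by (simp_all add: box_le_def)

lemma computes_best:
  "computes solver 4 (Node (Num m) (Node (val_of_box a) (boxes bs)))
     (val_of_box (best (box_le m) a bs)) (400 * length bs + 10)"
proof (induction bs arbitrary: a)
  case Nil
  show ?case
    apply (rule computes_solverI)
    unfolding best_body_def boxes_simps
    apply (rule evb_mono, rule evb_CondF, (rule evb_intros)+)
    apply simp
    apply (rule evb_intros)+
    by (simp_all add: boxes_simps)
next
  case (Cons b bs)
  show ?case
    apply (rule computes_solverI)
    unfolding best_body_def boxes_simps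
    apply (rule evb_mono, rule evb_CondT, (rule evb_intros)+)
    apply simp
    apply (rule computes_le evb_intros)+
    unfolding if_distrib[of val_of_box, symmetric]
    apply (rule Cons)
    by (simp_all add: boxes_simps)
qed

lemma filter_box_test:
  "filter (box_test 3 w) bs = filter upward bs"
  "filter (box_test 4 w) bs = filter (\<lambda>q. \<not> upward q) bs"
  "filter (box_test 5 w) bs = filter (\<lambda>q. cy q = cy w) bs"
  "filter (box_test 6 w) bs = filter (\<lambda>q. cx q = cx w) bs"
  "filter (box_test 7 w) bs = filter (compatible w) bs"
  by (simp_all add: box_test_def cong: filter_cong)

lemma box_test_key: "m \<le> 2 \<Longrightarrow> box_test m w q \<longleftrightarrow> box_key m q \<noteq> box_key m w"
  by (auto simp: box_test_def box_key_def)

lemmas computes_filter_Cons = computes_filter[of m w "b # bs" for m w b bs, unfolded boxes_simps]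

text \<open>A round takes linear time and shortens the list, so the rounds add up to a square of the
  length, whatever \<open>k\<close> is.\<close>

lemma computes_topk:
  assumes "m \<le> 2"
  shows "computes solver 5 (Node (Num m) (Node (Num k) (boxes bs))) (boxes (box_topk m k bs))
    (1100 * (length bs + 1) ^ 2)"
proof (induction k arbitrary: bs)
  case 0
  show ?case
    apply (rule computes_solverI)
    unfolding topk_body_def
    apply (rule evb_mono, rule evb_CondF, (rule evb_intros)+)
    apply simp
    apply (rule evb_intros)+
    by (simp_all add: boxes_simps power2_eq_square)
next
  case (Suc k)
  show ?case
  proof (cases bs)
    case Nil
    show ?thesis
      apply (rule computes_solverI)
      unfolding topk_body_def Nil boxes_simps
      apply (rule evb_mono, rule evb_CondF, (rule evb_intros)+)
      apply simp
      apply (rule evb_intros)+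
      by (simp_all add: boxes_simps)
  next
    case (Cons x xs)
    define b where "b = best (box_le m) x xs"
    define ys where "ys = filter (box_test m b) (x # xs)"
    have ys: "ys = filter (\<lambda>q. box_key m q \<noteq> box_key m b) (x # xs)"
      unfolding ys_def using assms by (intro filter_cong) (auto simp: box_test_key)
    have len: "length ys \<le> length xs"
      unfolding ys b_def by (rule length_filter_best)
    have eq: "box_topk m (Suc k) (x # xs) = b # box_topk m k ys"
      unfolding ys b_def by (simp add: Let_def)
    have best: "computes solver 4 (Node (Num m) (Node (val_of_box x) (boxes xs))) (val_of_box b)
        (400 * length xs + 10)"
      unfolding b_def by (rule computes_best)
    have fil: "computes solver 2 (Node (Num m) (Node (val_of_box b) (Node (val_of_box x) (boxes xs))))
        (boxes ys) (600 * length (x # xs) + 10)"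
      unfolding ys_def by (rule computes_filter_Cons)
    have rec: "computes solver 5 (Node (Num m) (Node (Num (Suc k - 1)) (boxes ys)))
        (boxes (box_topk m k ys)) (1100 * (length xs + 1) ^ 2)"
      by (rule computes_mono, simp, rule Suc.IH) (use len in \<open>auto intro: power_mono\<close>)
    show ?thesis
      unfolding Cons eq
      apply (rule computes_solverI)
      unfolding topk_body_def boxes_simps
      apply (rule evb_mono, rule evb_CondT, (rule evb_intros)+)
      apply simp
      apply (rule best fil rec evb_intros)+
      by (simp_all add: boxes_simps power2_eq_square)
  qed
qed

lemma computes_append:
  "computes solver 6 (Node (boxes xs) (boxes ys)) (boxes (xs @ ys)) (40 * length xs + 20)"
proof (induction xs)
  case Nil
  show ?case
    apply (rule computes_solverI)
    unfolding append_body_def boxes_simps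
    apply (rule evb_mono, rule evb_CondF, (rule evb_intros)+)
    apply simp
    apply (rule evb_intros)+
    by (simp_all add: boxes_simps)
next
  case (Cons b bs)
  show ?case
    apply (rule computes_solverI)
    unfolding append_body_def boxes_simps
    apply (rule evb_mono, rule evb_CondT, (rule evb_intros)+)
    apply simp
    apply (rule Cons evb_intros)+
    by (simp_all add: boxes_simps)
qed

lemma computes_grid:
  "computes solver 7 (Node (Num k) (Node (boxes D) (boxes cs))) (boxes (grid_cands k D cs))
    (2000 * (length D + 1) ^ 2 * length cs + 20)"
proof (induction cs)
  case Nil
  show ?case
    apply (rule computes_solverI)
    unfolding grid_body_def boxes_simps
    apply (rule evb_mono, rule evb_CondF, (rule evb_intros)+)
    apply simp
    apply (rule evb_intros)+
    by (simp_all add: boxes_simps grid_cands_def)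
next
  case (Cons c cs)
  define G where "G = filter (box_test 6 c) D"
  have G: "computes solver 2 (Node (Num 6) (Node (val_of_box c) (boxes D))) (boxes G)
      (600 * length D + 10)"
    unfolding G_def by (rule computes_filter)
  have len: "length G \<le> length D" by (simp add: G_def)
  have T: "computes solver 5 (Node (Num 2) (Node (Num k) (boxes G))) (boxes (box_topk 2 k G))
      (1100 * (length D + 1) ^ 2)"
    by (rule computes_mono, rule computes_topk) (use len in \<open>auto intro: power_mono\<close>)
  have "length (box_topk 2 k G) \<le> length D"
    using length_topk_le len le_trans by blast
  then have A: "computes solver 6 (Node (boxes (box_topk 2 k G)) (boxes (grid_cands k D cs)))
      (boxes (box_topk 2 k G @ grid_cands k D cs)) (40 * length D + 20)"
    by (intro computes_mono[OF computes_append]) auto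
  have eq: "grid_cands k D (c # cs) = box_topk 2 k G @ grid_cands k D cs"
    by (simp add: grid_cands_def G_def filter_box_test)
  show ?case
    unfolding eq
    apply (rule computes_solverI)
    unfolding grid_body_def boxes_simps
    apply (rule evb_mono, rule evb_CondT, (rule evb_intros)+)
    apply simp
    apply (rule G T A Cons evb_intros)+
    by (simp_all add: boxes_simps power2_eq_square algebra_simps)
qed

definition dummy :: box where "dummy = Box 0 0 0 0 0 0 0"

lemma evb_dummyE: "evb p env dummyE (val_of_box dummy) 13"
  unfolding dummyE_def dummy_def by (rule evb_mono, (rule evb_intros)+) auto

text \<open>The cube stems from a quadratic selection in each of at most \<open>n\<close>
  columns.\<close>

lemma computes_cands:
  assumes "length F \<le> n"
  shows "computes solver 8 (Node (Num k) (boxes F)) (boxes (cands k F)) (10000 * (n + 1) ^ 3)"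
proof -
  define D where "D = filter (\<lambda>b. \<not> upward b) F"
  define U where "U = filter upward F"
  have len: "length D \<le> n" "length U \<le> n"
    unfolding D_def U_def using assms length_filter_le le_trans by blast+
  have sq: "(length bs + 1)\<^sup>2 \<le> (n + 1)\<^sup>2" if "length bs \<le> n" for bs :: "box list"
    using that by (intro power_mono) auto
  have fD: "computes solver 2 (Node (Num 4) (Node (val_of_box dummy) (boxes F))) (boxes D) (600 * n + 10)"
    by (rule computes_mono[OF computes_filter]) (use assms in \<open>auto simp: D_def filter_box_test\<close>)
  have fU: "computes solver 2 (Node (Num 3) (Node (val_of_box dummy) (boxes F))) (boxes U) (600 * n + 10)"
    by (rule computes_mono[OF computes_filter]) (use assms in \<open>auto simp: U_def filter_box_test\<close>)
  have fil: "computes solver 2 (Node (Num 5) (Node (val_of_box u) (boxes bs)))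
      (boxes (filter (\<lambda>q. cy q = cy u) bs)) (600 * n + 10)" if "length bs \<le> n" for u bs
    by (rule computes_mono[OF computes_filter]) (use that in \<open>auto simp: filter_box_test\<close>)
  have top: "computes solver 5 (Node (Num m) (Node (Num k) (boxes bs))) (boxes (box_topk m k bs))
      (1100 * (n + 1)\<^sup>2)" if "length bs \<le> n" "m \<le> 2" for m bs
    by (rule computes_mono[OF computes_topk]) (use that sq in auto)
  have app: "computes solver 6 (Node (boxes bs) (boxes ds)) (boxes (bs @ ds)) (80 * n + 20)"
    if "length bs \<le> 2 * n" for bs ds
    by (rule computes_mono[OF computes_append]) (use that in auto)
  have ltop: "length (box_topk m k bs) \<le> n" if "length bs \<le> n" for m bs
    using that length_topk_le le_trans by blast
  have lf: "length (filter P bs) \<le> n" if "length bs \<le> n" for P and bs :: "box list"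
    using that length_filter_le le_trans by blast
  have "(length D + 1)\<^sup>2 * length (box_topk 0 k D) \<le> (n + 1)\<^sup>2 * (n + 1)"
    using mult_le_mono[OF sq[OF len(1)], of "length (box_topk 0 k D)" "n + 1"]
      ltop[OF len(1), of 0] by simp
  then have g: "computes solver 7 (Node (Num k) (Node (boxes D) (boxes (box_topk 0 k D))))
      (boxes (grid_cands k D (box_topk 0 k D))) (2000 * (n + 1) ^ 3 + 20)"
    by (intro computes_mono[OF computes_grid]) (auto simp: power3_eq_cube power2_eq_square algebra_simps)
  have cands: "cands k F = row_cands k U D @ grid_cands k D (box_topk 0 k D)"
    by (simp add: cands_def D_def U_def Let_def)
  define R where "R = row_cands k U D"
  \<comment> \<open>This part is evaluated separately because a case distinction on \<open>U\<close>
    is needed: if \<open>U\<close> is empty, the branch that takes its head is stuck.\<close>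
  have row: "evb solver [boxes U, boxes D, Node (Num k) (boxes F)]
       (Cond (IsNode (Var 0))
         (Bind (Call 4 (Mk (Const 0) (Var 0)))
           (Call 6 (Mk
             (Call 5 (Mk (Const 1) (Mk (Left (Var 3)) (Call 2 (Mk (Const 5) (Mk (Var 0) (Var 1)))))))
             (Call 5 (Mk (Const 1) (Mk (Left (Var 3)) (Call 2 (Mk (Const 5) (Mk (Var 0) (Var 2))))))))))
         (Const 0)) (boxes R) (4000 * (n + 1)\<^sup>2) \<and> length R \<le> 2 * n"
  proof (cases U)
    case Nil
    have "R = []" by (simp add: R_def row_cands_def Nil)
    moreover have "evb solver [boxes U, boxes D, Node (Num k) (boxes F)] (Cond (IsNode (Var 0)) e (Const 0))
        (boxes []) (4000 * (n + 1)\<^sup>2)" for e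
      unfolding Nil boxes_simps
      apply (rule evb_mono, rule evb_CondF, (rule evb_intros)+)
      apply simp
      apply (rule evb_intros)+
      by (simp_all add: power2_eq_square)
    ultimately show ?thesis by simp
  next
    case (Cons x xs)
    define u where "u = best (box_le 0) x xs"
    have R: "R = box_topk 1 k (filter (\<lambda>q. cy q = cy u) U) @ box_topk 1 k (filter (\<lambda>q. cy q = cy u) D)"
      by (simp add: R_def row_cands_def Cons u_def Let_def)
    have best: "computes solver 4 (Node (Num 0) (boxes U)) (val_of_box u) (400 * n + 10)"
      unfolding u_def Cons boxes_simps
      by (rule computes_mono[OF computes_best]) (use len Cons in auto)
    note l = lf[OF len(1)] lf[OF len(2)]
    have lR: "length R \<le> 2 * n"
      unfolding R using ltop[OF l(1)] ltop[OF l(2)] by (simp add: add_mono mult_2)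
    have "length (box_topk 1 k (filter (\<lambda>q. cy q = cy u) U)) \<le> 2 * n"
      using ltop[OF l(2), of 1 "\<lambda>q. cy q = cy u"] by simp
    note app1 = app[OF this]
    have node: "is_node (boxes U)" by (simp add: Cons boxes_simps)
    show ?thesis
      unfolding R
      apply (rule conjI)
       apply (rule evb_mono, rule evb_CondT, (rule evb_intros)+)
          apply (simp add: node)
         apply (rule best app1 top[OF l(1)] top[OF l(2)] fil[OF len(1)] fil[OF len(2)] evb_intros | simp; fail)+
      using lR by (simp_all add: R power2_eq_square)
  qed
  note row1 = conjunct1[OF row] and appR = app[OF conjunct2[OF row]]
  show ?thesis
    unfolding cands R_def[symmetric]
    apply (rule computes_solverI)
    unfolding cands_body_def
    apply (rule evb_mono, (rule fD fU row1 g appR top[OF len(1)] evb_dummyE evb_intros | simp; fail)+)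
    by (simp_all add: power2_eq_square power3_eq_cube algebra_simps)
qed

text \<open>A call with parameter \<open>k > 0\<close> makes at most \<open>3 * k ^ 2\<close>
  recursive calls. The factor \<open>4\<close> in place of \<open>3\<close> leaves a quarter of the
  bound for finding the candidates and filtering the list.\<close>

lemma computes_search:
  "length F \<le> n \<Longrightarrow> computes solver 9 (Node (Num k) (boxes F)) (Num (of_bool (search k F)))
     (20000 * (n + 1) ^ 3 * (4 ^ k * (fact k)\<^sup>2))"
proof (induction k arbitrary: F)
  case 0
  show ?case
    apply (rule computes_solverI)
    unfolding search_body_def
    apply (rule evb_mono, rule evb_CondT, (rule evb_intros)+)
    apply simp
    apply (rule evb_intros)+
    by (simp_all add: power3_eq_cube)
next
  case (Suc k)
  define M where "M = (n + 1) ^ 3"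
  have M: "n + 1 \<le> M"
    unfolding M_def by (rule self_le_power) auto
  define g :: nat where "g = 4 ^ k * (fact k)\<^sup>2"
  have g: "1 \<le> g" by (simp add: g_def)
  let ?T = "700 * M + 20000 * M * g"
  have step: "computes solver 10 (Node (Num (Suc k)) (Node (boxes F) (boxes cs)))
      (Num (of_bool (\<exists>w\<in>set cs. search k (filter (compatible w) F)))) (?T * length cs + 10)" for cs
  proof (induction cs)
    case Nil
    show ?case
      apply (rule computes_solverI)
      unfolding try_body_def boxes_simps
      apply (rule evb_mono, rule evb_CondF, (rule evb_intros)+)
      apply simp
      apply (rule evb_intros)+
      by simp_all
  next
    case (Cons w cs)
    define F' where "F' = filter (compatible w) F"
    have "length F' \<le> n" unfolding F'_def using Suc.prems length_filter_le le_trans by blast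
    then have S: "computes solver 9 (Node (Num (Suc k - 1)) (boxes F')) (Num (of_bool (search k F')))
        (20000 * M * g)"
      using Suc.IH unfolding M_def g_def by simp
    have fil: "computes solver 2 (Node (Num 7) (Node (val_of_box w) (boxes F))) (boxes F') (600 * n + 10)"
      by (rule computes_mono[OF computes_filter]) (use Suc.prems in \<open>auto simp: F'_def filter_box_test\<close>)
    show ?case
      apply (rule computes_solverI)
      unfolding try_body_def boxes_simps
      apply (rule evb_mono, rule evb_CondT, (rule evb_intros)+)
        apply simp
       apply (rule fil S Cons.IH evb_intros)+
      using M by (auto simp: F'_def algebra_simps)
  qed
  define L where "L = Suc k * Suc k"
  have L: "1 \<le> L" "Suc k \<le> L" by (auto simp: L_def)
  have "length (cands (Suc k) F) \<le> L + 2 * Suc k"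
    unfolding L_def by (rule length_cands)
  moreover have "2 * Suc k \<le> 2 * L" using L(2) by (rule mult_le_mono2)
  ultimately have "length (cands (Suc k) F) \<le> 3 * L" by linarith
  then have "?T * length (cands (Suc k) F) \<le> ?T * (3 * L)" by (rule mult_le_mono2)
  also have "\<dots> = 2100 * (M * L) + 60000 * (M * L * g)" by (simp add: algebra_simps)
  finally have time: "?T * length (cands (Suc k) F) \<le> 2100 * (M * L) + 60000 * (M * L * g)" .
  have T: "computes solver 10 (Node (Num (Suc k)) (Node (boxes F) (boxes (cands (Suc k) F))))
      (Num (of_bool (search (Suc k) F))) (2100 * (M * L) + 60000 * (M * L * g) + 10)"
    using time by (intro computes_mono[OF step]) auto
  have C: "computes solver 8 (Node (Num (Suc k)) (boxes F)) (boxes (cands (Suc k) F)) (10000 * M)"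
    unfolding M_def by (rule computes_cands) (rule Suc.prems)
  have bounds: "M \<le> M * L" "1 \<le> M * L" "M * L \<le> M * L * g"
    using M L g by (auto simp: Suc_le_eq)
  have eq: "20000 * M * (4 ^ Suc k * (fact (Suc k))\<^sup>2) = 80000 * (M * L * g)"
    by (simp add: L_def g_def power2_eq_square algebra_simps)
  show ?case
    unfolding M_def[symmetric] eq
    apply (rule computes_solverI)
    unfolding search_body_def
    apply (rule evb_mono, rule evb_CondF, (rule evb_intros)+)
      apply simp
     apply (rule T C evb_intros)+
     apply simp
    using bounds by linarith
qed

section \<open>Estimating the size of the search tree\<close>

lemma fact_bound: "2 ^ k * fact k \<le> 2 * k ^ k"
proof (induction k)
  case (Suc k)
  show ?case
  proof (cases "k = 0")
    case False
    \<comment> \<open>Bernoulli gives \<open>(1 + 1 / k) ^ k \<ge> 2\<close>, which pays for the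
      factor \<open>2\<close> in each step from \<open>k\<close> to \<open>Suc k\<close>.\<close>
    have "1 + real k * (1 / real k) \<le> (1 + 1 / real k) ^ k"
      by (rule Bernoulli_inequality) (auto intro: order_trans[of _ 0])
    then have "2 \<le> ((real k + 1) / real k) ^ k"
      using False by (simp add: field_simps)
    then have "2 * real k ^ k \<le> (real k + 1) ^ k"
      using False by (simp add: field_simps power_divide)
    then have "2 * k ^ k \<le> (k + 1) ^ k"
      by (metis (mono_tags, lifting) of_nat_1 of_nat_add of_nat_le_iff of_nat_mult of_nat_numeral of_nat_power)
    have "2 ^ Suc k * fact (Suc k) = 2 * Suc k * (2 ^ k * fact k)" by (simp add: algebra_simps)
    also have "\<dots> \<le> 2 * Suc k * (2 * k ^ k)" using Suc.IH by (rule mult_le_mono2)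
    also have "\<dots> \<le> 2 * Suc k * (k + 1) ^ k" using \<open>2 * k ^ k \<le> (k + 1) ^ k\<close> by (rule mult_le_mono2)
    finally show ?thesis by simp
  qed simp
qed simp

lemma search_time: "4 ^ k * (fact k)\<^sup>2 \<le> 4 * k ^ (2 * k)" for k :: nat
proof -
  have "(2 ^ k * fact k)\<^sup>2 \<le> (2 * k ^ k)\<^sup>2" by (rule power_mono[OF fact_bound]) simp
  moreover have "(2 ^ k)\<^sup>2 = (4 :: nat) ^ k" "(k ^ k)\<^sup>2 = k ^ (2 * k)"
    by (simp_all add: power2_eq_square mult_2 power_add flip: power_mult_distrib)
  ultimately show ?thesis by (simp add: power_mult_distrib)
qed

section \<open>Reading boxes off the input\<close>

text \<open>Reflecting at \<open>n\<close> instead of \<open>n - 1\<close> may leave the grid by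
  one, which is harmless: coordinates do not exceed \<open>n\<close>, so truncated subtraction is
  injective on them and reverses their order.\<close>

definition flip :: "bool \<Rightarrow> nat \<Rightarrow> nat \<Rightarrow> nat" where
  "flip b n x = (if b then n - x else x)"

text \<open>Two waypoints mean a path without bend. Its lower left end is declared the corner after
  the reflection, so it is always \<open>upward\<close> with its corner at the left end and is never
  dropped.\<close>

definition waypoint_box :: "bool \<Rightarrow> bool \<Rightarrow> nat \<Rightarrow> nat \<Rightarrow> nat \<Rightarrow> point list \<Rightarrow> box" where
  "waypoint_box i j W H v ws =
     (let x = flip i W (fst (hd ws)); y = flip j H (snd (hd ws));
          x' = flip i W (fst (last ws)); y' = flip j H (snd (last ws)) in
      Box v
        (if length ws = 3 then flip i W (fst (ws ! 1)) else min x x')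
        (if length ws = 3 then flip j H (snd (ws ! 1)) else min y y')
        (min x x') (max x x') (min y y') (max y y'))"

definition norm_boxes :: "bool \<Rightarrow> bool \<Rightarrow> nat \<Rightarrow> nat \<Rightarrow> (nat \<Rightarrow> point list) \<Rightarrow> nat list \<Rightarrow> box list" where
  "norm_boxes i j W H P vs = filter (\<lambda>b. cy b \<le> vl b \<or> cx b = hl b)
     (map (\<lambda>v. waypoint_box i j W H v (waypoints (P v))) vs)"

definition params :: "bool \<Rightarrow> bool \<Rightarrow> nat \<Rightarrow> nat \<Rightarrow> val" where
  "params i j W H = Node (Node (Num (of_bool i)) (Num (of_bool j))) (Node (Num W) (Num H))"

lemma evb_IteE: "evb p env e (Num (of_bool P)) t \<Longrightarrow> evb p env a (Num m) t1 \<Longrightarrow> evb p env b (Num m') t2 \<Longrightarrow>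
    evb p env (IteE e a b) (Num (if P then m else m')) (t + max t1 t2 + 1)"
  unfolding IteE_def by (rule evb_mono[OF evb_Cond]) auto

lemma evb_flipE:
  assumes "evb p env (Var k) (Node (params i j W H) v) 1" "evb p env e (Num x) t"
  shows "evb p env (flipE k e) (Num (flip i W x)) (t + 20)"
    "evb p env (flopE k e) (Num (flip j H x)) (t + 20)"
  unfolding flipE_def flopE_def
  by (rule evb_mono, (rule evb_IteE assms[unfolded params_def] evb_intros)+; simp add: flip_def)+

text \<open>A relation instead of a function, so that \<open>last_ptI\<close> finds the last of two
  or three waypoints by unification during the evaluation.\<close>

definition last_pt :: "val \<Rightarrow> val \<Rightarrow> bool" where
  "last_pt r v \<longleftrightarrow> (\<exists>m. r = Node v (Num m)) \<or> (\<exists>b d. r = Node b (Node v d))"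

lemma last_ptI: "last_pt (Node b (Num m)) b" "last_pt (Node b (Node c d)) c"
  by (auto simp: last_pt_def)

lemma evb_lastE:
  assumes e: "evb p env e (Node a r) t" and "last_pt r v"
  shows "evb p env (lastE e) v (2 * t + 10)"
proof -
  consider m where "r = Node v (Num m)" | b d where "r = Node b (Node v d)"
    using assms(2) by (auto simp: last_pt_def)
  then show ?thesis
  proof cases
    case 1
    show ?thesis
      unfolding lastE_def
      by (rule evb_mono, rule evb_CondF, (rule e[unfolded 1] evb_intros)+, simp,
        (rule e[unfolded 1] evb_intros)+) simp_all
  next
    case 2
    show ?thesis
      unfolding lastE_def
      by (rule evb_mono, rule evb_CondT, (rule e[unfolded 2] evb_intros)+, simp,
        (rule e[unfolded 2] evb_intros)+) simp_all
  qed
qed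

lemma computes_box:
  assumes "length ws = 2 \<or> length ws = 3"
  shows "computes solver 11 (Node (params i j W H) (Node (Num v) (val_of_list (map val_of_pair ws))))
    (val_of_box (waypoint_box i j W H v ws)) 500"
proof -
  consider a b a' b' where "ws = [(a, b), (a', b')]" |
    a b a' b' c d where "ws = [(a, b), (c, d), (a', b')]"
    using assms by (auto simp: length_Suc_conv numeral_eq_Suc)
  then show ?thesis
  proof cases
    case 1
    show ?thesis
      apply (rule computes_solverI)
      unfolding box_body_def 1 list.map val_of_list.simps val_of_pair.simps
      apply (rule evb_mono, (rule last_ptI evb_flipE evb_lastE evb_IteE evb_intros)+)
      by (simp_all add: waypoint_box_def Let_def)
  next
    case 2
    show ?thesis
      apply (rule computes_solverI)
      unfolding box_body_def 2 list.map val_of_list.simps val_of_pair.simps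
      apply (rule evb_mono, (rule last_ptI evb_flipE evb_lastE evb_IteE evb_intros)+)
      by (simp_all add: waypoint_box_def Let_def)
  qed
qed

lemma computes_norm:
  assumes "\<forall>v\<in>set vs. length (waypoints (P v)) = 2 \<or> length (waypoints (P v)) = 3"
  shows "computes solver 12 (Node (params i j W H)
      (val_of_list (map (\<lambda>v. Node (Num v) (val_of_path (P v))) vs)))
    (boxes (norm_boxes i j W H P vs)) (700 * length vs + 10)"
  using assms
proof (induction vs)
  case Nil
  show ?case
    apply (rule computes_solverI)
    unfolding norm_body_def list.map val_of_list.simps
    apply (rule evb_mono, rule evb_CondF, (rule evb_intros)+)
    apply simp
    apply (rule evb_intros)+
    by (simp_all add: boxes_simps norm_boxes_def)
next
  case (Cons v vs)
  define b where "b = waypoint_box i j W H v (waypoints (P v))"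
  have b: "computes solver 11 (Node (params i j W H) (Node (Num v) (val_of_path (P v))))
     (val_of_box b) 500"
    unfolding b_def val_of_path_def by (rule computes_box) (use Cons.prems in auto)
  have IH: "computes solver 12 (Node (params i j W H)
      (val_of_list (map (\<lambda>v. Node (Num v) (val_of_path (P v))) vs)))
    (boxes (norm_boxes i j W H P vs)) (700 * length vs + 10)"
    using Cons by simp
  show ?case
    apply (rule computes_solverI)
    unfolding norm_body_def list.map val_of_list.simps
    apply (rule evb_mono, rule evb_CondT, (rule evb_intros)+)
    apply simp
    apply (rule b IH evb_intros)+
    by (auto simp add: boxes_simps norm_boxes_def b_def[symmetric])
qed

lemma runs_solver:
  assumes "\<forall>v\<in>set vs. length (waypoints (P v)) = 2 \<or> length (waypoints (P v)) = 3"
  shows "\<exists>t\<le>1000000 * (k ^ (2 * k) * (length vs + 1) ^ 3). runs solver (encode_input vs es W H P k)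
    (val_of_bool (\<exists>i j. search k (norm_boxes i j W H P vs))) t"
proof -
  define M where "M = (length vs + 1) ^ 3"
  have M: "length vs + 1 \<le> M" unfolding M_def by (rule self_le_power) auto
  define I where "I = encode_input vs es W H P k"
  have I: "I = Node (Num k) (Node (Node (Num W) (Num H))
      (Node (val_of_list (map (\<lambda>v. Node (Num v) (val_of_path (P v))) vs))
        (Node (val_of_list (map val_of_pair es)) (Num 0))))"
    by (simp add: I_def encode_input_def)
  let ?K = "k ^ (2 * k)"
  \<comment> \<open>For \<open>k = 0\<close> this rests on \<open>0 ^ 0 = 1\<close>.\<close>
  have K: "1 \<le> ?K" by (cases "k = 0") (auto simp: Suc_le_eq)
  have S: "computes solver 9 (Node (Num k) (boxes (norm_boxes i j W H P vs)))
      (Num (of_bool (search k (norm_boxes i j W H P vs)))) (80000 * (M * ?K))" for i j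
  proof (rule computes_mono[OF computes_search])
    show "length (norm_boxes i j W H P vs) \<le> length vs"
      unfolding norm_boxes_def by (metis length_filter_le length_map)
    show "20000 * (length vs + 1) ^ 3 * (4 ^ k * (fact k)\<^sup>2) \<le> 80000 * (M * ?K)"
      using mult_le_mono2[OF search_time[of k], of "20000 * M"] by (simp add: M_def)
  qed simp
  note N = computes_norm[OF assms, unfolded params_def]
  have main: "evb solver [I] (main_call i' j') (Num (of_bool (search k (norm_boxes i j W H P vs))))
      (81000 * (M * ?K))" if "i' = of_bool i" "j' = of_bool j" for i j i' j'
  proof -
    have "M \<le> M * ?K" using K by simp
    then have "700 * length vs + 10 + 80000 * (M * ?K) + 60 \<le> 81000 * (M * ?K)"
      using M by linarith
    then show ?thesis
      unfolding main_call_def I that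
      by - (rule evb_mono, (rule S N evb_intros)+, simp_all)
  qed
  have "evb solver [I] main_body (val_of_bool (\<exists>i j. search k (norm_boxes i j W H P vs)))
      (1000000 * (?K * M))"
  proof -
    have "1 \<le> M * ?K" using M K by simp
    \<comment> \<open>Four reflections cost \<open>4 * 81000\<close>, and the three disjunctions
      \<open>6\<close> more.\<close>
    then have "324000 * (M * ?K) + 6 \<le> 1000000 * (?K * M)" by (subst mult.commute) linarith
    moreover have "evb solver [I] main_body (Num (of_bool (\<exists>i j. search k (norm_boxes i j W H P vs))))
        (324000 * (M * ?K) + 6)"
      unfolding main_body_def
      by (rule evb_mono, (rule evb_OrE main[of 0 False 0 False] main[of 0 False 1 True]
        main[of 1 True 0 False] main[of 1 True 1 True] | simp; fail)+) (auto simp: ex_bool_eq)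
    ultimately show ?thesis
      by (elim evb_mono) (simp_all add: val_of_bool_def)
  qed
  then show ?thesis
    by (auto simp: evb_def runs_def solver_def I_def M_def)
qed


section \<open>Boxes of grid paths\<close>

lemma path_edges_simps:
  "path_edges [] = {}" "path_edges [p] = {}"
  "path_edges (p # q # ps) = insert {p, q} (path_edges (q # ps))"
proof -
  show "path_edges (p # q # ps) = insert {p, q} (path_edges (q # ps))" (is "?L = ?R")
  proof
    show "?L \<subseteq> ?R"
    proof
      fix e assume "e \<in> ?L"
      then obtain i where "e = {(p # q # ps) ! i, (p # q # ps) ! Suc i}" "Suc i < length (p # q # ps)"
        by (auto simp: path_edges_def)
      then show "e \<in> ?R" by (cases i) (auto simp: path_edges_def)
    qed
    show "?R \<subseteq> ?L"
    proof
      fix e assume "e \<in> ?R"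
      then consider "e = {p, q}" | i where "e = {(q # ps) ! i, (q # ps) ! Suc i}" "Suc i < length (q # ps)"
        by (auto simp: path_edges_def)
      then show "e \<in> ?L"
      proof cases
        case 1
        then show ?thesis unfolding path_edges_def by (intro CollectI exI[of _ 0]) auto
      next
        case 2
        then show ?thesis unfolding path_edges_def by (intro CollectI exI[of _ "Suc i"]) auto
      qed
    qed
  qed
qed (auto simp: path_edges_def)

lemma path_edges_append:
  "xs \<noteq> [] \<Longrightarrow> path_edges (xs @ ys) = path_edges xs \<union> path_edges (last xs # ys)"
proof (induction xs rule: induct_list012)
  case (3 x y zs)
  then show ?case by (simp add: path_edges_simps)
qed (auto simp: path_edges_simps)

lemma path_edges_rev: "path_edges (rev xs) = path_edges xs"
proof (induction xs rule: induct_list012)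
  case (3 x y zs)
  then show ?case
    using path_edges_append[of "rev (y # zs)" "[x]"]
    by (simp add: path_edges_simps insert_commute)
qed simp_all

lemma path_edges_upt:
  "path_edges (map f [a..<Suc (a + n)]) = {{f t, f (Suc t)} | t. a \<le> t \<and> t < a + n}"
proof (induction n)
  case (Suc n)
  have "[a..<Suc (a + Suc n)] = [a..<Suc (a + n)] @ [Suc (a + n)]" by simp
  then have "path_edges (map f [a..<Suc (a + Suc n)]) =
      path_edges (map f [a..<Suc (a + n)]) \<union> {{f (a + n), f (Suc (a + n))}}"
    using path_edges_append[of "map f [a..<Suc (a + n)]" "[f (Suc (a + n))]"]
    by (simp add: path_edges_simps last_map del: upt_Suc)
  then show ?case
    unfolding Suc by (auto simp: less_Suc_eq)
qed (simp add: path_edges_simps)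

lemma path_edges_seg:
  "path_edges (map f (seg a b)) = {{f t, f (Suc t)} | t. min a b \<le> t \<and> t < max a b}"
proof (cases "a \<le> b")
  case True
  then show ?thesis
    using path_edges_upt[of f a "b - a"] by (simp add: seg_def del: upt_Suc)
next
  case False
  then show ?thesis
    using path_edges_upt[of f b "a - b"]
    by (simp add: seg_def path_edges_rev rev_map[symmetric] del: upt_Suc)
qed

lemma seg_props:
  "length (seg a b) = Suc (max a b - min a b)" "distinct (seg a b)"
  "seg a b \<noteq> []" "hd (seg a b) = a" "last (seg a b) = b"
  by (auto simp: seg_def hd_rev last_rev simp del: upt_Suc)

lemma seg_tl: "seg a b = a # tl (seg a b)"
  using seg_props[of a b] by (metis list.collapse)

lemma path_edges_corner_path:
  "path_edges (corner_path x y a b) =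
     {{(x, t), (x, Suc t)} | t. min a y \<le> t \<and> t < max a y} \<union>
     {{(t, y), (Suc t, y)} | t. min x b \<le> t \<and> t < max x b}"
proof -
  \<comment> \<open>The corner is listed once, at the end of the vertical part. Put in front of the
    remaining points, it restores the whole horizontal part.\<close>
  have "last (map (\<lambda>j. (x, j)) (seg a y)) # tl (map (\<lambda>i. (i, y)) (seg x b)) = map (\<lambda>i. (i, y)) (seg x b)"
    using seg_props[of a y] by (subst (3) seg_tl) (simp add: last_map map_tl)
  then show ?thesis
    unfolding corner_path_def
    by (subst path_edges_append) (simp_all add: seg_props path_edges_seg)
qed

lemma corner_path_props:
  fixes x y a b :: nat
  defines "m \<equiv> max a y - min a y" and "h \<equiv> max x b - min x b"
  shows "length (corner_path x y a b) = Suc (m + h)" "hd (corner_path x y a b) = (x, a)"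
    "last (corner_path x y a b) = (b, y)" "corner_path x y a b ! m = (x, y)"
    "bend_at (corner_path x y a b) i \<longleftrightarrow> Suc i = m \<and> 0 < h"
proof -
  let ?p = "corner_path x y a b"
  have lens: "length (seg a y) = Suc m" "length (seg x b) = Suc h"
    by (simp_all add: seg_props m_def h_def)
  show len: "length ?p = Suc (m + h)" by (simp add: corner_path_def lens)
  have vert: "?p ! i = (x, seg a y ! i)" if "i \<le> m" for i
    using that by (simp add: corner_path_def nth_append lens)
  have ym: "seg a y ! m = y"
    using seg_props(3,5)[of a y] lens by (simp add: last_conv_nth)
  have x0: "seg x b ! 0 = x" using seg_props(3,4)[of x b] by (simp add: hd_conv_nth)
  have hor: "?p ! i = (seg x b ! (i - m), y)" if "m \<le> i" "i \<le> m + h" for i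
  proof (cases "i = m")
    case True
    then show ?thesis using vert[of m] by (simp add: ym x0)
  next
    case False
    then have "?p ! i = tl (map (\<lambda>i. (i, y)) (seg x b)) ! (i - Suc m)"
      using that by (simp add: corner_path_def nth_append lens)
    also have "\<dots> = (seg x b ! (i - m), y)"
      using that False lens by (subst nth_tl) (auto simp: Suc_diff_Suc)
    finally show ?thesis .
  qed
  show "?p ! m = (x, y)" using vert[of m] ym by simp
  have ne: "?p \<noteq> []" using len by auto
  show "hd ?p = (x, a)"
    using vert[of 0] ne seg_props(3,4)[of a y] by (simp add: hd_conv_nth)
  show "last ?p = (b, y)"
    using hor[of "m + h"] ne len seg_props(3,5)[of x b] lens by (simp add: last_conv_nth)
  show "bend_at ?p i \<longleftrightarrow> Suc i = m \<and> 0 < h"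
  proof -
    consider "Suc (Suc i) \<le> m" | "m \<le> i" | "Suc i = m" by linarith
    then show ?thesis
    proof cases
      case 1
      then show ?thesis using vert[of i] vert[of "Suc (Suc i)"] by (auto simp: bend_at_def)
    next
      case 2
      then show ?thesis using hor[of i] hor[of "Suc (Suc i)"] by (auto simp: bend_at_def len)
    next
      case 3
      have "seg a y ! i \<noteq> y"
        using seg_props(2)[of a y] 3 lens ym nth_eq_iff_index_eq[of "seg a y" i m] by auto
      moreover have "seg x b ! 1 \<noteq> x" if "0 < h"
        using seg_props(2)[of x b] that lens x0 nth_eq_iff_index_eq[of "seg x b" 1 0] by auto
      ultimately show ?thesis
        using 3 vert[of i] hor[of "Suc (Suc i)"] by (auto simp: bend_at_def len)
    qed
  qed
qed

text \<open>Here \<open>m\<close> and \<open>h\<close> are the numbers of edges before and after the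
  corner. The path itself is left abstract because the reversed path is covered by exchanging
  \<open>m\<close> and \<open>h\<close>.\<close>

lemma waypoints_eq:
  assumes "\<And>i. bend_at ps i \<longleftrightarrow> Suc i = m \<and> 0 < h" "length ps = Suc (m + h)"
  shows "waypoints ps = hd ps # (if 0 < m \<and> 0 < h then [ps ! m] else []) @ [last ps]"
proof -
  have one: "filter (\<lambda>i. i = c) [0..<n] = (if c < n then [c] else [])" for c n :: nat
    by (induction n) auto
  have "filter (bend_at ps) [0..<length ps] = (if 0 < m \<and> 0 < h then [m - 1] else [])"
  proof (cases "0 < m \<and> 0 < h")
    case True
    then have "bend_at ps = (\<lambda>i. i = m - 1)" using assms(1) by auto
    then show ?thesis using True one[of "m - 1" "length ps"] assms(2) by simp
  next
    case False
    then show ?thesis using assms(1) by (auto simp: filter_empty_conv)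
  qed
  then show ?thesis by (simp add: waypoints_def)
qed

text \<open>A bend is indexed by the first of three consecutive points. Reversal makes that point
  the last of the three, which accounts for \<open>3\<close> instead of \<open>1\<close>.\<close>

lemma bend_at_rev:
  "bend_at (rev ps) i \<longleftrightarrow> Suc (Suc i) < length ps \<and> bend_at ps (length ps - 3 - i)"
proof (cases "Suc (Suc i) < length ps")
  case True
  then have "rev ps ! i = ps ! Suc (Suc (length ps - 3 - i))"
    "rev ps ! Suc (Suc i) = ps ! (length ps - 3 - i)"
    by (auto simp: rev_nth intro!: arg_cong[of _ _ "nth ps"])
  then show ?thesis using True by (auto simp: bend_at_def)
qed (simp add: bend_at_def)

lemma waypoints_corner_path:
  fixes x y a b :: nat
  defines "ws \<equiv> (x, a) # (if a \<noteq> y \<and> x \<noteq> b then [(x, y)] else []) @ [(b, y)]"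
  shows "waypoints (corner_path x y a b) = ws" "waypoints (rev (corner_path x y a b)) = rev ws"
proof -
  let ?p = "corner_path x y a b"
  define m where "m = max a y - min a y"
  define h where "h = max x b - min x b"
  note p = corner_path_props[of x y a b, folded m_def h_def]
  have mh: "0 < m \<longleftrightarrow> a \<noteq> y" "0 < h \<longleftrightarrow> x \<noteq> b" by (auto simp: m_def h_def)
  show "waypoints ?p = ws"
    using waypoints_eq[OF p(5,1)] by (simp add: p ws_def mh)
  have ne: "?p \<noteq> []" using p(1) by auto
  have "bend_at (rev ?p) i \<longleftrightarrow> Suc i = h \<and> 0 < m" for i
    unfolding bend_at_rev p by auto
  moreover have "length (rev ?p) = Suc (h + m)" using p by simp
  moreover have "rev ?p ! h = (x, y)"
    using p by (subst rev_nth) auto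
  ultimately have "waypoints (rev ?p) = last ?p # (if 0 < h \<and> 0 < m then [(x, y)] else []) @ [hd ?p]"
    using waypoints_eq[of "rev ?p" h m] ne by (simp add: hd_rev last_rev)
  then show "waypoints (rev ?p) = rev ws" by (simp add: p ws_def mh)
qed

section \<open>Clashes of boxes and common grid edges\<close>

definition corner_box :: "bool \<Rightarrow> bool \<Rightarrow> nat \<Rightarrow> nat \<Rightarrow> nat \<Rightarrow> nat \<Rightarrow> nat \<Rightarrow> nat \<Rightarrow> nat \<Rightarrow> box" where
  "corner_box i j W H v x y a b =
     (let x' = flip i W x; y' = flip j H y; a' = flip j H a; b' = flip i W b; c = (a \<noteq> y \<and> x \<noteq> b) in
      Box v (if c then x' else min x' b') (if c then y' else min a' y')
        (min x' b') (max x' b') (min a' y') (max a' y'))"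

lemma waypoint_box_corner_path:
  assumes "ps = corner_path x y a b \<or> ps = rev (corner_path x y a b)"
  shows "waypoint_box i j W H v (waypoints ps) = corner_box i j W H v x y a b"
  using assms
  by (auto simp: waypoints_corner_path waypoint_box_def corner_box_def Let_def min.commute max.commute)

lemma corner_box_sel:
  "hl (corner_box i j W H v x y a b) = min (flip i W x) (flip i W b)"
  "hr (corner_box i j W H v x y a b) = max (flip i W x) (flip i W b)"
  "vl (corner_box i j W H v x y a b) = min (flip j H a) (flip j H y)"
  "vr (corner_box i j W H v x y a b) = max (flip j H a) (flip j H y)"
  "x \<noteq> b \<Longrightarrow> cy (corner_box i j W H v x y a b) = flip j H y"
  "a \<noteq> y \<Longrightarrow> cx (corner_box i j W H v x y a b) = flip i W x"
  by (auto simp: corner_box_def Let_def)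

text \<open>Reflection exchanges \<open>min\<close> and \<open>max\<close> but preserves the overlap
  of intervals. The row or column stored in a box is that of an arm only if the arm is nonempty. An
  overlap guarantees this, so coordinates are compared only under \<open>?X\<close> or
  \<open>?Y\<close>.\<close>

lemma clash_corner_box:
  assumes "x \<le> W" "b \<le> W" "y \<le> H" "a \<le> H" "x' \<le> W" "b' \<le> W" "y' \<le> H" "a' \<le> H"
  shows "clash (corner_box i j W H u x y a b) (corner_box i j W H v x' y' a' b') \<longleftrightarrow>
    path_edges (corner_path x y a b) \<inter> path_edges (corner_path x' y' a' b') \<noteq> {}"
    (is "?C \<longleftrightarrow> ?E")
proof -
  have overlap: "max (min (flip i n s) (flip i n t)) (min (flip i n s') (flip i n t')) <
       min (max (flip i n s) (flip i n t)) (max (flip i n s') (flip i n t')) \<longleftrightarrow>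
       max (min s t) (min s' t') < min (max s t) (max s' t')"
    if "s \<le> n" "t \<le> n" "s' \<le> n" "t' \<le> n" for i n s t s' t'
  proof -
    have diff: "min (n - k) (n - l) = n - max k l" "max (n - k) (n - l) = n - min k l" for k l :: nat
      by auto
    have "min (max s t) (max s' t') \<le> n" using that by simp
    then have "n - min (max s t) (max s' t') < n - max (min s t) (min s' t') \<longleftrightarrow>
        max (min s t) (min s' t') < min (max s t) (max s' t')"
      by linarith
    then show ?thesis by (cases i) (simp_all only: flip_def diff if_True if_False)
  qed
  have inj: "flip i n s = flip i n t \<longleftrightarrow> s = t" if "s \<le> n" "t \<le> n" for i n s t
    using that by (auto simp: flip_def)
  have "?C \<longleftrightarrow> y = y' \<and> max (min x b) (min x' b') < min (max x b) (max x' b') \<or>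
      x = x' \<and> max (min a y) (min a' y') < min (max a y) (max a' y')"
  proof -
    let ?b = "corner_box i j W H u x y a b" and ?b' = "corner_box i j W H v x' y' a' b'"
    let ?X = "max (min x b) (min x' b') < min (max x b) (max x' b')"
    let ?Y = "max (min a y) (min a' y') < min (max a y) (max a' y')"
    have X: "cy ?b = cy ?b' \<longleftrightarrow> y = y'" if ?X
    proof -
      have "x \<noteq> b" "x' \<noteq> b'" using that by auto
      then show ?thesis using inj[OF assms(3,7)] by (simp add: corner_box_sel)
    qed
    have Y: "cx ?b = cx ?b' \<longleftrightarrow> x = x'" if ?Y
    proof -
      have "a \<noteq> y" "a' \<noteq> y'" using that by auto
      then show ?thesis using inj[OF assms(1,5)] by (simp add: corner_box_sel)
    qed
    show ?thesis
      unfolding clash_def corner_box_sel overlap[OF assms(1,2,5,6)] overlap[OF assms(4,3,8,7)]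
      using X Y by blast
  qed
  also have "\<dots> \<longleftrightarrow> ?E"
  proof
    assume "y = y' \<and> max (min x b) (min x' b') < min (max x b) (max x' b') \<or>
      x = x' \<and> max (min a y) (min a' y') < min (max a y) (max a' y')"
    then show ?E
    proof
      assume *: "y = y' \<and> max (min x b) (min x' b') < min (max x b) (max x' b')"
      define t where "t = max (min x b) (min x' b')"
      have "min x b \<le> t" "t < max x b" "min x' b' \<le> t" "t < max x' b'"
        using * by (auto simp: t_def)
      then have "{(t, y), (Suc t, y)} \<in> path_edges (corner_path x y a b)"
        "{(t, y), (Suc t, y)} \<in> path_edges (corner_path x' y' a' b')"
        using * unfolding path_edges_corner_path by blast+
      then show ?E by blast
    next
      assume *: "x = x' \<and> max (min a y) (min a' y') < min (max a y) (max a' y')"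
      define t where "t = max (min a y) (min a' y')"
      have "min a y \<le> t" "t < max a y" "min a' y' \<le> t" "t < max a' y'"
        using * by (auto simp: t_def)
      then have "{(x, t), (x, Suc t)} \<in> path_edges (corner_path x y a b)"
        "{(x, t), (x, Suc t)} \<in> path_edges (corner_path x' y' a' b')"
        using * unfolding path_edges_corner_path by blast+
      then show ?E by blast
    qed
  next
    assume ?E
    then obtain e where e: "e \<in> path_edges (corner_path x y a b)" "e \<in> path_edges (corner_path x' y' a' b')"
      by blast
    have edge_eq: "{(c, t), (c, Suc t)} = {(c', t'), (c', Suc t')} \<longleftrightarrow> c = c' \<and> t = t'"
      "{(t, c), (Suc t, c)} = {(t', c'), (Suc t', c')} \<longleftrightarrow> c = c' \<and> t = t'"
      "{(c, t), (c, Suc t)} \<noteq> {(t', c'), (Suc t', c')}"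
      "{(t', c'), (Suc t', c')} \<noteq> {(c, t), (c, Suc t)}" for c t c' t' :: nat
      by (auto simp: doubleton_eq_iff)
    have between: "p \<le> t \<Longrightarrow> q \<le> t \<Longrightarrow> t < r \<Longrightarrow> t < s \<Longrightarrow> max p q < min r s" for p q r s t :: nat
      by simp
    have "(\<exists>t. e = {(x, t), (x, Suc t)} \<and> min a y \<le> t \<and> t < max a y) \<or>
        (\<exists>t. e = {(t, y), (Suc t, y)} \<and> min x b \<le> t \<and> t < max x b)"
      using e(1) unfolding path_edges_corner_path by blast
    moreover have "(\<exists>t. e = {(x', t), (x', Suc t)} \<and> min a' y' \<le> t \<and> t < max a' y') \<or>
        (\<exists>t. e = {(t, y'), (Suc t, y')} \<and> min x' b' \<le> t \<and> t < max x' b')"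
      using e(2) unfolding path_edges_corner_path by blast
    ultimately show "y = y' \<and> max (min x b) (min x' b') < min (max x b) (max x' b') \<or>
      x = x' \<and> max (min a y) (min a' y') < min (max a y) (max a' y')"
      by (elim disjE exE conjE) (simp only: edge_eq; use between in blast)+
  qed
  finally show ?thesis .
qed

lemma box_ok_corner_box:
  fixes i j W H v x y a b
  defines "c \<equiv> corner_box i j W H v x y a b"
  assumes "y \<le> H" "a \<le> H" and kept: "cy c \<le> vl c \<or> cx c = hl c"
  shows "box_ok c"
proof -
  define X Y A B where "X = flip i W x" "Y = flip j H y" "A = flip j H a" "B = flip i W b"
  have c: "c = (let p = a \<noteq> y \<and> x \<noteq> b in Box v (if p then X else min X B) (if p then Y else min A Y)
      (min X B) (max X B) (min A Y) (max A Y))"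
    by (simp add: c_def corner_box_def X_Y_A_B_def Let_def)
  \<comment> \<open>Reflection must not empty a vertical arm: for \<open>vl = vr\<close>,
    \<open>box_ok\<close> wants the corner at the left end, which is granted only to paths without
    bend.\<close>
  have "A = Y \<longleftrightarrow> a = y"
    using assms(2,3) by (auto simp: X_Y_A_B_def flip_def)
  then show ?thesis
    using kept unfolding c box_ok_def upward_def Let_def
    by (cases "a \<noteq> y \<and> x \<noteq> b") (auto simp: min_def max_def split: if_splits)
qed

lemma three_shapes_missing:
  assumes "three_shapes V P"
  obtains s where "\<And>v. v \<in> V \<Longrightarrow> \<exists>s'. s' \<noteq> s \<and> has_shape s' (P v)"
proof -
  obtain S where S: "card S = 3" "\<forall>v\<in>V. \<exists>s\<in>S. has_shape s (P v)"
    using assms by (auto simp: three_shapes_def)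
  have "(UNIV :: shape set) = {Up_Right, Down_Right, Down_Left, Up_Left}"
    using shape.exhaust by blast
  then have "card (UNIV :: shape set) = card {Up_Right, Down_Right, Down_Left, Up_Left}"
    by (rule arg_cong)
  then have "S \<noteq> UNIV" using S(1) by auto
  then obtain s where "s \<notin> S" by blast
  then have "\<exists>s'. s' \<noteq> s \<and> has_shape s' (P v)" if "v \<in> V" for v
    using S(2) that by metis
  then show ?thesis by (rule that)
qed

section \<open>From the representation to the search\<close>

locale three_shape_rep =
  fixes V :: "nat set" and E W H P vs es
  assumes simple: "simple_graph V E" and rep: "B1_EPG_rep V E W H P"
    and shapes: "three_shapes V P" and enum: "enumerates vs es V E"
begin

lemma path_cases:
  assumes "v \<in> V" "has_shape s (P v)"
  obtains x y a b where "arms s x y a b" "x \<le> W" "b \<le> W" "y \<le> H" "a \<le> H"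
    "path_edges (P v) = path_edges (corner_path x y a b)"
    "\<And>i j. waypoint_box i j W H v (waypoints (P v)) = corner_box i j W H v x y a b"
    "length (waypoints (P v)) = 2 \<or> length (waypoints (P v)) = 3"
proof -
  obtain x y a b where s: "arms s x y a b"
    "P v = corner_path x y a b \<or> P v = rev (corner_path x y a b)"
    using assms(2) by (auto simp: has_shape_def)
  have "set (P v) \<subseteq> grid W H"
    using rep assms(1) by (auto simp: B1_EPG_rep_def EPG_rep_def grid_path_def)
  moreover have "set (P v) = set (corner_path x y a b)" using s(2) by auto
  moreover have "corner_path x y a b \<noteq> []" using corner_path_props(1)[of x y a b] by auto
  then have "(x, a) \<in> set (corner_path x y a b)" "(b, y) \<in> set (corner_path x y a b)"
    using corner_path_props(2,3)[of x y a b] by (metis hd_in_set, metis last_in_set)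
  ultimately have "x \<le> W" "b \<le> W" "y \<le> H" "a \<le> H" by (auto simp: grid_def)
  moreover have "path_edges (P v) = path_edges (corner_path x y a b)"
    using s(2) path_edges_rev by metis
  moreover have "length (waypoints (P v)) = 2 \<or> length (waypoints (P v)) = 3"
    using s(2) by (auto simp: waypoints_corner_path split: if_splits)
  moreover have "waypoint_box i j W H v (waypoints (P v)) = corner_box i j W H v x y a b" for i j
    using s(2) by (rule waypoint_box_corner_path)
  ultimately show ?thesis using that[OF s(1)] by simp
qed

lemma shape_exists: "v \<in> V \<Longrightarrow> \<exists>s. has_shape s (P v)"
  using three_shapes_missing[OF shapes] by metis

abbreviation "pbox i j v \<equiv> waypoint_box i j W H v (waypoints (P v))"

lemma bid_pbox: "bid (pbox i j v) = v"
  by (simp add: waypoint_box_def Let_def)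

lemma set_vs: "set vs = V"
  using enum by (auto simp: enumerates_def)

lemma norm_boxes_set:
  "set (norm_boxes i j W H P vs) = {pbox i j v | v. v \<in> V \<and> (cy (pbox i j v) \<le> vl (pbox i j v) \<or>
     cx (pbox i j v) = hl (pbox i j v))}"
  unfolding norm_boxes_def using set_vs by auto

lemma adjacent_iff_clash:
  assumes "u \<in> V" "v \<in> V" "u \<noteq> v"
  shows "{u, v} \<in> E \<longleftrightarrow> clash (pbox i j u) (pbox i j v)"
proof -
  have "{u, v} \<in> E \<longleftrightarrow> path_edges (P u) \<inter> path_edges (P v) \<noteq> {}"
    using rep assms by (auto simp: B1_EPG_rep_def EPG_rep_def)
  moreover obtain s s' where s: "has_shape s (P u)" "has_shape s' (P v)"
    using shape_exists assms by blast
  obtain x y a b where u: "x \<le> W" "b \<le> W" "y \<le> H" "a \<le> H"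
    "path_edges (P u) = path_edges (corner_path x y a b)" "pbox i j u = corner_box i j W H u x y a b"
    using path_cases[OF assms(1) s(1)] by metis
  obtain x' y' a' b' where v: "x' \<le> W" "b' \<le> W" "y' \<le> H" "a' \<le> H"
    "path_edges (P v) = path_edges (corner_path x' y' a' b')"
    "pbox i j v = corner_box i j W H v x' y' a' b'"
    using path_cases[OF assms(2) s(2)] by metis
  ultimately show ?thesis
    using clash_corner_box[OF u(1-4) v(1-4)] by (simp add: u v)
qed

lemma independent_iff_stable:
  assumes "S \<subseteq> V"
  shows "independent_set V E S \<longleftrightarrow> stable (pbox i j ` S)"
proof -
  \<comment> \<open>\<open>independent_set\<close> also tests \<open>u = v\<close>, where the pair
    collapses to a singleton.\<close>
  have loop: "{u} \<notin> E" for u using simple by (fastforce simp: simple_graph_def)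
  have "{u, v} \<notin> E \<longleftrightarrow> (pbox i j u \<noteq> pbox i j v \<longrightarrow> \<not> clash (pbox i j u) (pbox i j v))"
    if "u \<in> S" "v \<in> S" for u v
  proof (cases "u = v")
    case True
    then show ?thesis using loop by simp
  next
    case False
    then have "pbox i j u \<noteq> pbox i j v" using bid_pbox by metis
    then show ?thesis using adjacent_iff_clash[of u v i j] that assms False by auto
  qed
  then show ?thesis
    using assms unfolding independent_set_def stable_def by simp
qed

lemma box_ok_norm: "b \<in> set (norm_boxes i j W H P vs) \<Longrightarrow> box_ok b"
proof -
  assume "b \<in> set (norm_boxes i j W H P vs)"
  then obtain v where v: "v \<in> V" "b = pbox i j v" "cy b \<le> vl b \<or> cx b = hl b"
    by (auto simp: norm_boxes_set)
  obtain s where "has_shape s (P v)" using shape_exists v by blast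
  then obtain x y a c where "y \<le> H" "a \<le> H" "b = corner_box i j W H v x y a c"
    using path_cases[OF v(1)] v(2) by metis
  then show ?thesis
    using v(3) box_ok_corner_box by blast
qed

lemma search_norm:
  "(\<exists>i j. search k (norm_boxes i j W H P vs)) \<longleftrightarrow> (\<exists>S. independent_set V E S \<and> k \<le> card S)"
proof -
  have inj: "inj_on bid (set (norm_boxes i j W H P vs))" for i j
    by (auto simp: inj_on_def norm_boxes_set bid_pbox)
  have iff: "search k (norm_boxes i j W H P vs) \<longleftrightarrow>
      (\<exists>S\<subseteq>set (norm_boxes i j W H P vs). stable S \<and> card S = k)" for i j
    using box_ok_norm inj by (intro search_iff) auto
  have pinj: "inj_on (pbox i j) S" for i j S
    by (rule inj_on_inverseI[of _ bid]) (rule bid_pbox)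
  show ?thesis
  proof
    assume "\<exists>i j. search k (norm_boxes i j W H P vs)"
    then obtain i j T where T: "T \<subseteq> set (norm_boxes i j W H P vs)" "stable T" "card T = k"
      using iff by blast
    then have "T \<subseteq> pbox i j ` V" by (auto simp: norm_boxes_set)
    then obtain S where S: "S \<subseteq> V" "T = pbox i j ` S" by (meson subset_imageE)
    then show "\<exists>S. independent_set V E S \<and> k \<le> card S"
      using T independent_iff_stable card_image[OF pinj] by (metis order_refl)
  next
    assume "\<exists>S. independent_set V E S \<and> k \<le> card S"
    then obtain S' where S': "independent_set V E S'" "k \<le> card S'" by blast
    then obtain S where S: "S \<subseteq> S'" "card S = k"
      by (meson obtain_subset_with_card_n)
    have SV: "S \<subseteq> V" "independent_set V E S"
      using S S' by (auto simp: independent_set_def)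
    obtain s0 where s0: "\<And>v. v \<in> V \<Longrightarrow> \<exists>s. s \<noteq> s0 \<and> has_shape s (P v)"
      using three_shapes_missing[OF shapes] by metis
    \<comment> \<open>These reflections carry \<open>s0\<close> to \<open>Down_Left\<close>: right
      has to become left, and up has to become down.\<close>
    define i where "i \<longleftrightarrow> s0 = Down_Right \<or> s0 = Up_Right"
    define j where "j \<longleftrightarrow> s0 = Up_Right \<or> s0 = Up_Left"
    have "cy (pbox i j v) \<le> vl (pbox i j v) \<or> cx (pbox i j v) = hl (pbox i j v)" if "v \<in> V" for v
    proof -
      obtain s where s: "s \<noteq> s0" "has_shape s (P v)" using s0 \<open>v \<in> V\<close> by blast
      obtain x y a b where c: "arms s x y a b" "x \<le> W" "b \<le> W" "y \<le> H" "a \<le> H"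
        "pbox i j v = corner_box i j W H v x y a b"
        using path_cases[OF \<open>v \<in> V\<close> s(2)] by metis
      have "flip j H y \<le> flip j H a \<or> flip i W x \<le> flip i W b"
        using c(1-5) s(1) by (cases s0; cases s) (auto simp: i_def j_def flip_def)
      then show ?thesis
        unfolding c(6) by (auto simp: corner_box_def Let_def)
    qed
    then have "pbox i j ` S \<subseteq> set (norm_boxes i j W H P vs)"
      using SV unfolding norm_boxes_set by blast
    moreover have "stable (pbox i j ` S)" using independent_iff_stable SV by blast
    moreover have "card (pbox i j ` S) = k" using S card_image[OF pinj] by metis
    ultimately show "\<exists>i j. search k (norm_boxes i j W H P vs)" using iff by blast
  qed
qed

lemma runs_solver_correct:
  "\<exists>t\<le>1000000 * (k ^ (2 * k) * poly ([:1, 1:] ^ 3) (card V)).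
     runs solver (encode_input vs es W H P k)
       (val_of_bool (\<exists>S. independent_set V E S \<and> k \<le> card S)) t"
proof -
  have "\<forall>v\<in>set vs. length (waypoints (P v)) = 2 \<or> length (waypoints (P v)) = 3"
    using set_vs shape_exists path_cases by metis
  moreover have "card V = length vs"
    using enum set_vs distinct_card by (auto simp: enumerates_def)
  ultimately show ?thesis
    using runs_solver[of vs P k es W H] by (simp add: search_norm poly_power add.commute)
qed

end

theorem theorem3:
  "\<exists>(p :: program) (c :: nat) (q :: nat poly).
     \<forall>(V :: nat set) E W H P vs es (k :: nat).
       simple_graph V E \<and> B1_EPG_rep V E W H P \<and> three_shapes V P \<and> enumerates vs es V E \<longrightarrow>
       (\<exists>t \<le> c * (k ^ (2 * k) * poly q (card V)).
          runs p (encode_input vs es W H P k)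
            (val_of_bool (\<exists>S. independent_set V E S \<and> card S \<ge> k)) t)"
  using three_shape_rep.runs_solver_correct[OF three_shape_rep.intro]
  by (intro exI[of _ solver] exI[of _ 1000000] exI[of _ "[:1, 1:] ^ 3"]) blast

end
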